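(* There is a polynomial time algorithm that decides whether a given digraph $D$ whose unique strong component with more than one vertex is a subdivision of a multiwheel or of a split multiwheel has a dicycle $B$ in $D$ and a cycle $C$ in $\mathrm{UG}(D)$ with $V(B)\cap V(C)=\emptyset$, and finds such $B,C$ if they exist.
   Context: Digraphs are finite, loops and multiple arcs allowed; a dicycle is a directed cycle, a cycle is a cycle of $\mathrm{UG}(D)$. A multiwheel is obtained from a dicycle $c_0c_1\dots c_{p-1}c_0$, $p\ge3$, by adding a new vertex $v$ and, for each $i$, $\ell_i$ arcs from $v$ to $c_i$ and $k_i$ arcs from $c_i$ to $v$, where $\ell_i+k_i\ge1$. A split multiwheel is obtained from a multiwheel by replacing $v$ by two vertices $v^-,v^+$, adding the arc $v^-v^+$, and letting all arcs entering $v$ enter $v^-$ and all arcs leaving $v$ leave $v^+$. A subdivision of a digraph is obtained by replacing arcs by dipaths with new internal vertices. *)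

theory Defs
  imports "Graph_Theory.Graph_Theory" "HOL-Computational_Algebra.Polynomial"
begin

section \<open>Model of computation\<close>

text \<open>
  Algorithms are programs of a first-order, call-by-value functional language over binary
  trees (the language F of N. D. Jones, ``Computability and Complexity from a Programming
  Perspective'', with several arguments per function): pure LISP with cons, car, cdr, a test for
  the empty tree and recursive functions. A program is the list of its function bodies; the
  arguments of a function are its variables 0, 1, 2, ...; function 0 is the main function.
  The running time is the number of evaluation steps. Every step creates at most one cons
  cell, so a computation of t steps is simulated with sharing by a Turing machine or a RAM in
  time polynomial in t and the input size, and conversely.
\<close>

datatype sexp = Leaf | Node sexp sexp

datatype expr =
    Var nat
  | Empty
  | Cons_of expr expr
  | Left expr
  | Right expr
  | Cond expr expr expr
  | Call nat "expr list"

type_synonym program = "expr list"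

primrec left :: "sexp \<Rightarrow> sexp" where
  "left Leaf = Leaf"
| "left (Node x y) = x"

primrec right :: "sexp \<Rightarrow> sexp" where
  "right Leaf = Leaf"
| "right (Node x y) = y"

text \<open>
  \<open>eval P env e x t\<close>: under program \<open>P\<close>, with variable values \<open>env\<close>, expression \<open>e\<close>
  evaluates to \<open>x\<close> in \<open>t\<close> steps. Unbound variables and undefined functions have no
  evaluation.
\<close>

inductive eval :: "program \<Rightarrow> sexp list \<Rightarrow> expr \<Rightarrow> sexp \<Rightarrow> nat \<Rightarrow> bool"
  and evals :: "program \<Rightarrow> sexp list \<Rightarrow> expr list \<Rightarrow> sexp list \<Rightarrow> nat \<Rightarrow> bool"
  for P :: program
  where
  eval_Var: "i < length env \<Longrightarrow> eval P env (Var i) (env ! i) 1"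
| eval_Empty: "eval P env Empty Leaf 1"
| eval_Cons: "eval P env e1 x1 t1 \<Longrightarrow> eval P env e2 x2 t2 \<Longrightarrow>
    eval P env (Cons_of e1 e2) (Node x1 x2) (t1 + t2 + 1)"
| eval_Left: "eval P env e x t \<Longrightarrow> eval P env (Left e) (left x) (t + 1)"
| eval_Right: "eval P env e x t \<Longrightarrow> eval P env (Right e) (right x) (t + 1)"
| eval_Cond_Node: "eval P env e (Node y z) t \<Longrightarrow> eval P env e1 x t1 \<Longrightarrow>
    eval P env (Cond e e1 e2) x (t + t1 + 1)"
| eval_Cond_Leaf: "eval P env e Leaf t \<Longrightarrow> eval P env e2 x t2 \<Longrightarrow>
    eval P env (Cond e e1 e2) x (t + t2 + 1)"
| eval_Call: "f < length P \<Longrightarrow> evals P env es xs t \<Longrightarrow> eval P xs (P ! f) x t' \<Longrightarrow>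
    eval P env (Call f es) x (t + t' + 1)"
| evals_Nil: "evals P env [] [] 0"
| evals_Cons: "eval P env e x t \<Longrightarrow> evals P env es xs t' \<Longrightarrow>
    evals P env (e # es) (x # xs) (t + t')"

inductive_cases eval_VarE: "eval P env (Var i) x t"
inductive_cases eval_EmptyE: "eval P env Empty x t"
inductive_cases eval_ConsE: "eval P env (Cons_of e1 e2) x t"
inductive_cases eval_LeftE: "eval P env (Left e) x t"
inductive_cases eval_RightE: "eval P env (Right e) x t"
inductive_cases eval_CondE: "eval P env (Cond e e1 e2) x t"
inductive_cases eval_CallE: "eval P env (Call f es) x t"
inductive_cases evals_NilE: "evals P env [] xs t"
inductive_cases evals_ConsE: "evals P env (e # es) xs t"

lemma eval_deterministic:
  "eval P env e x t \<Longrightarrow> eval P env e x' t' \<Longrightarrow> x' = x \<and> t' = t"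
  "evals P env es xs t \<Longrightarrow> evals P env es xs' t' \<Longrightarrow> xs' = xs \<and> t' = t"
proof (induction arbitrary: x' t' and xs' t' rule: eval_evals.inducts)
  case (eval_Var i env) then show ?case by (auto elim: eval_VarE)
next
  case (eval_Empty env) then show ?case by (auto elim: eval_EmptyE)
next
  case (eval_Cons env e1 x1 t1 e2 x2 t2)
  from eval_Cons.prems show ?case
    by (rule eval_ConsE) (auto dest!: eval_Cons.IH(2,4))
next
  case (eval_Left env e x t)
  from eval_Left.prems show ?case
    by (rule eval_LeftE) (auto dest!: eval_Left.IH(2))
next
  case (eval_Right env e x t)
  from eval_Right.prems show ?case
    by (rule eval_RightE) (auto dest!: eval_Right.IH(2))
next
  case (eval_Cond_Node env e y z t e1 x t1 e2)
  from eval_Cond_Node.prems show ?case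
    by (rule eval_CondE) (auto dest!: eval_Cond_Node.IH(2,4))
next
  case (eval_Cond_Leaf env e t e2 x t2 e1)
  from eval_Cond_Leaf.prems show ?case
    by (rule eval_CondE) (auto dest!: eval_Cond_Leaf.IH(2,4))
next
  case (eval_Call f env es xs t x t1)
  from eval_Call.prems show ?case
    by (rule eval_CallE) (auto dest!: eval_Call.IH(3,5))
next
  case (evals_Nil env) then show ?case by (auto elim: evals_NilE)
next
  case (evals_Cons env e x t es xs t1)
  from evals_Cons.prems show ?case
    by (rule evals_ConsE) (auto dest!: evals_Cons.IH(2,4))
qed

definition run :: "program \<Rightarrow> sexp \<Rightarrow> sexp \<Rightarrow> nat \<Rightarrow> bool" where
  "run P x y t \<longleftrightarrow> P \<noteq> [] \<and> eval P [x] (P ! 0) y t"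

text \<open>
  There is a polynomial time algorithm that, given any instance \<open>x\<close> with \<open>promise x\<close>,
  outputs some \<open>y\<close> with \<open>spec x y\<close>.
\<close>

definition poly_time_solvable ::
  "('i \<Rightarrow> sexp) \<Rightarrow> ('o \<Rightarrow> sexp) \<Rightarrow> ('i \<Rightarrow> nat) \<Rightarrow> ('i \<Rightarrow> bool) \<Rightarrow> ('i \<Rightarrow> 'o \<Rightarrow> bool) \<Rightarrow> bool" where
  "poly_time_solvable enc_in enc_out sz promise spec \<longleftrightarrow>
     (\<exists>(P :: program) (q :: nat poly). \<forall>x. promise x \<longrightarrow>
        (\<exists>y t. run P (enc_in x) (enc_out y) t \<and> t \<le> poly q (sz x) \<and> spec x y))"


section \<open>Digraphs as inputs\<close>

text \<open>
  An input \<open>(n, as)\<close> is a digraph with vertices \<open>0, ..., n - 1\<close> given by the list of the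
  (tail, head) pairs of its arcs. Arcs are identified by their position in the list,
  so loops and multiple arcs are allowed.
\<close>

type_synonym digraph_input = "nat \<times> (nat \<times> nat) list"

definition wf_input :: "digraph_input \<Rightarrow> bool" where
  "wf_input I \<longleftrightarrow> (\<forall>(u, v) \<in> set (snd I). u < fst I \<and> v < fst I)"

definition digraph_of :: "digraph_input \<Rightarrow> (nat, nat) pre_digraph" where
  "digraph_of I =
     \<lparr> verts = {..<fst I}, arcs = {..<length (snd I)},
       tail = \<lambda>a. fst (snd I ! a), head = \<lambda>a. snd (snd I ! a) \<rparr>"

lemma fin_digraph_digraph_of: "wf_input I \<Longrightarrow> fin_digraph (digraph_of I)"
  by unfold_locales
     (auto simp: wf_input_def digraph_of_def split_beta)

definition input_size :: "digraph_input \<Rightarrow> nat" where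
  "input_size I = fst I + length (snd I)"

text \<open>
  Numbers are encoded in unary. All numbers involved are at most \<open>input_size I\<close>, so the
  encoding is polynomial in \<open>input_size I\<close>.
\<close>

primrec enc_nat :: "nat \<Rightarrow> sexp" where
  "enc_nat 0 = Leaf"
| "enc_nat (Suc n) = Node Leaf (enc_nat n)"

primrec enc_list :: "('a \<Rightarrow> sexp) \<Rightarrow> 'a list \<Rightarrow> sexp" where
  "enc_list enc [] = Leaf"
| "enc_list enc (x # xs) = Node (enc x) (enc_list enc xs)"

definition enc_pair :: "('a \<Rightarrow> sexp) \<Rightarrow> ('b \<Rightarrow> sexp) \<Rightarrow> 'a \<times> 'b \<Rightarrow> sexp" where
  "enc_pair enc1 enc2 = (\<lambda>(x, y). Node (enc1 x) (enc2 y))"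

definition enc_digraph :: "digraph_input \<Rightarrow> sexp" where
  "enc_digraph = enc_pair enc_nat (enc_list (enc_pair enc_nat enc_nat))"

definition enc_answer :: "(nat list \<times> nat list) option \<Rightarrow> sexp" where
  "enc_answer ans = (case ans of None \<Rightarrow> Leaf
     | Some BC \<Rightarrow> enc_pair (enc_list enc_nat) (enc_list enc_nat) BC)"

lemma inj_enc_nat: "inj enc_nat"
proof (rule injI)
  show "enc_nat m = enc_nat n \<Longrightarrow> m = n" for m n
  proof (induction m arbitrary: n)
    case 0 then show ?case by (cases n) auto
  next
    case (Suc m) then show ?case by (cases n) auto
  qed
qed

lemma inj_enc_list: "inj (enc_list enc)" if "inj enc"
proof (rule injI)
  show "enc_list enc xs = enc_list enc ys \<Longrightarrow> xs = ys" for xs ys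
  proof (induction xs arbitrary: ys)
    case Nil then show ?case by (cases ys) auto
  next
    case (Cons x xs) then show ?case by (cases ys) (auto dest: injD[OF that])
  qed
qed

lemma inj_enc_pair: "inj enc1 \<Longrightarrow> inj enc2 \<Longrightarrow> inj (enc_pair enc1 enc2)"
  by (auto simp: enc_pair_def inj_def)

lemma inj_enc_digraph: "inj enc_digraph"
  unfolding enc_digraph_def by (intro inj_enc_pair inj_enc_list inj_enc_nat)

lemma inj_enc_answer: "inj enc_answer"
proof (rule injI)
  fix x y assume *: "enc_answer x = enc_answer y"
  have "inj (enc_list enc_nat)"
    by (intro inj_enc_list inj_enc_nat)
  with * show "x = y"
    by (auto simp: enc_answer_def enc_pair_def dest: injD split: option.splits)
qed


section \<open>Multiwheels, split multiwheels and subdivisions\<close>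

datatype wheel_vert = Hub | Hub_minus | Hub_plus | Rim nat

datatype wheel_arc = Rim_arc nat | Out_spoke nat nat | In_spoke nat nat | Hub_arc

text \<open>
  The dicycle \<open>Rim 0, ..., Rim (p - 1)\<close> with the additional vertex \<open>Hub\<close>, \<open>l i\<close> arcs from
  \<open>Hub\<close> to \<open>Rim i\<close> and \<open>k i\<close> arcs from \<open>Rim i\<close> to \<open>Hub\<close>.
\<close>

definition wheel :: "nat \<Rightarrow> (nat \<Rightarrow> nat) \<Rightarrow> (nat \<Rightarrow> nat) \<Rightarrow> (wheel_vert, wheel_arc) pre_digraph" where
  "wheel p l k =
     \<lparr> verts = insert Hub (Rim ` {..<p}),
       arcs = Rim_arc ` {..<p} \<union> {Out_spoke i j |i j. i < p \<and> j < l i}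
                \<union> {In_spoke i j |i j. i < p \<and> j < k i},
       tail = (\<lambda>a. case a of Rim_arc i \<Rightarrow> Rim i | Out_spoke i j \<Rightarrow> Hub
                 | In_spoke i j \<Rightarrow> Rim i | Hub_arc \<Rightarrow> Hub_minus),
       head = (\<lambda>a. case a of Rim_arc i \<Rightarrow> Rim (Suc i mod p) | Out_spoke i j \<Rightarrow> Rim i
                 | In_spoke i j \<Rightarrow> Hub | Hub_arc \<Rightarrow> Hub_plus) \<rparr>"

definition split_hub ::
  "(wheel_vert, wheel_arc) pre_digraph \<Rightarrow> (wheel_vert, wheel_arc) pre_digraph" where
  "split_hub W =
     \<lparr> verts = (verts W - {Hub}) \<union> {Hub_minus, Hub_plus},
       arcs = insert Hub_arc (arcs W),
       tail = (\<lambda>a. if a = Hub_arc then Hub_minus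
                   else if tail W a = Hub then Hub_plus else tail W a),
       head = (\<lambda>a. if a = Hub_arc then Hub_plus
                   else if head W a = Hub then Hub_minus else head W a) \<rparr>"

definition multiwheels :: "(wheel_vert, wheel_arc) pre_digraph set" where
  "multiwheels = {wheel p l k |p l k. 3 \<le> p \<and> (\<forall>i<p. 1 \<le> l i + k i)}"

definition split_multiwheels :: "(wheel_vert, wheel_arc) pre_digraph set" where
  "split_multiwheels = split_hub ` multiwheels"

definition internal_verts :: "('a, 'b) pre_digraph \<Rightarrow> 'b list \<Rightarrow> 'a list" where
  "internal_verts H p = map (head H) (butlast p)"

text \<open>
  \<open>H\<close> is, up to isomorphism, obtained from \<open>W\<close> by replacing every arc \<open>a\<close> by a dipath
  \<open>Q a\<close> with at least one arc (the single arc meaning that \<open>a\<close> is kept) and new internal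
  vertices.
\<close>

definition subdivision_of :: "('a, 'b) pre_digraph \<Rightarrow> ('c, 'd) pre_digraph \<Rightarrow> bool" where
  "subdivision_of H W \<longleftrightarrow>
     (\<exists>f Q. inj_on f (verts W) \<and>
        (\<forall>a \<in> arcs W.
           Q a \<noteq> [] \<and> pre_digraph.awalk H (f (tail W a)) (Q a) (f (head W a)) \<and>
           distinct (internal_verts H (Q a)) \<and>
           set (internal_verts H (Q a)) \<inter> f ` verts W = {}) \<and>
        (\<forall>a \<in> arcs W. \<forall>b \<in> arcs W. a \<noteq> b \<longrightarrow>
           set (Q a) \<inter> set (Q b) = {} \<and>
           set (internal_verts H (Q a)) \<inter> set (internal_verts H (Q b)) = {}) \<and>
        verts H = f ` verts W \<union> (\<Union>a \<in> arcs W. set (internal_verts H (Q a))) \<and>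
        arcs H = (\<Union>a \<in> arcs W. set (Q a)))"

definition unique_nontrivial_scc_subdivided_multiwheel :: "('a, 'b) pre_digraph \<Rightarrow> bool" where
  "unique_nontrivial_scc_subdivided_multiwheel D \<longleftrightarrow>
     (\<exists>H. {H' \<in> pre_digraph.sccs D. 1 < card (verts H')} = {H} \<and>
          (\<exists>W \<in> multiwheels \<union> split_multiwheels. subdivision_of H W))"


section \<open>Disjoint dicycle and cycle\<close>

text \<open>
  The underlying multigraph \<open>UG(D)\<close> has vertex set \<open>verts D\<close> and edge set \<open>arcs D\<close>, where
  the edge \<open>a\<close> joins its two ends. A loop is a cycle of length 1, and two distinct edges
  with the same two ends form a cycle of length 2, whatever their directions in \<open>D\<close>.
\<close>

definition ug_ends :: "('a, 'b) pre_digraph \<Rightarrow> 'b \<Rightarrow> 'a set" where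
  "ug_ends D a = {tail D a, head D a}"

definition ug_cycle :: "('a, 'b) pre_digraph \<Rightarrow> 'b list \<Rightarrow> bool" where
  "ug_cycle D C \<longleftrightarrow> C \<noteq> [] \<and> set C \<subseteq> arcs D \<and> distinct C \<and>
     (\<exists>vs. length vs = length C \<and> distinct vs \<and> set vs \<subseteq> verts D \<and>
        (\<forall>i < length C. ug_ends D (C ! i) = {vs ! i, vs ! (Suc i mod length C)}))"

definition arcs_verts :: "('a, 'b) pre_digraph \<Rightarrow> 'b list \<Rightarrow> 'a set" where
  "arcs_verts D p = (\<Union>a \<in> set p. ug_ends D a)"

definition disjoint_dicycle_cycle :: "('a, 'b) pre_digraph \<Rightarrow> 'b list \<Rightarrow> 'b list \<Rightarrow> bool" where
  "disjoint_dicycle_cycle D B C \<longleftrightarrow>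
     pre_digraph.cycle D B \<and> ug_cycle D C \<and> arcs_verts D B \<inter> arcs_verts D C = {}"

definition correct_answer ::
  "('a, 'b) pre_digraph \<Rightarrow> ('b list \<times> 'b list) option \<Rightarrow> bool" where
  "correct_answer D ans \<longleftrightarrow> (case ans of
       None \<Rightarrow> \<not> (\<exists>B C. disjoint_dicycle_cycle D B C)
     | Some (B, C) \<Rightarrow> disjoint_dicycle_cycle D B C)"

end

theory Submission
  imports Defs
begin

text \<open>
  A dicycle of a subdivided (split) multiwheel either is the rim or enters and leaves the hub
  exactly once. In both cases it is the only dicycle that runs through a suitable arc \<open>a\<close> after
  all arcs with the same head as some \<open>b\<close>, except \<open>c\<close>, have been deleted: in the second case
  \<open>a\<close> lies on the spoke that leaves the hub and \<open>b = c\<close> is the last arc of the spoke that enters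
  it, and for the rim \<open>b\<close> is the last arc of any spoke towards the hub. A dicycle outside the
  nontrivial strong component is a loop. Hence for each triple \<open>a, b, c\<close> of arcs it suffices to
  find one dicycle through \<open>a\<close> in the remaining digraph and to look for a cycle of the underlying
  multigraph that avoids its vertices. Both are searches for a path from the head to the tail of
  an arc.
\<close>

section \<open>Dicycles of subdivided multiwheels\<close>

text \<open>The search may return another dicycle than the intended one. This does no harm as long
  as all its vertices lie on the intended one, for then every cycle that avoids the latter avoids
  the former; so uniqueness is used only as an inclusion \<open>A' \<subseteq> A\<close> of arc
  sets. The algorithm neither computes the strong component nor identifies a hub: every dicycle has
  some triple that is right for it, and a wrong triple can only yield another genuine pair or
  nothing. The deletion is needed because a walk that leaves the hub along \<open>a\<close> may
  return to it by many spokes. Once a single arc into the hub is left, the vertex where the rim is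
  left is fixed. Once no arc into the hub is left, nothing passes through the hub, and only the rim
  remains. Arc sets suit the passage to split wheels and subdivisions: replacing arcs by paths turns
  a set into a union of disjoint sets, whereas sequences would bring in a starting point and
  rotations.\<close>

text \<open>
  Arc sets of unions of disjoint dicycles. Unlike dicycles they are described locally, and this
  suffices below because such a union in a multiwheel is a single dicycle.
\<close>

definition cycset :: "('a, 'b) pre_digraph \<Rightarrow> 'b set \<Rightarrow> bool" where
  "cycset G A \<longleftrightarrow> A \<subseteq> arcs G \<and> A \<noteq> {} \<and> inj_on (tail G) A \<and> inj_on (head G) A \<and>
     tail G ` A = head G ` A"

text \<open>
  The arcs to which the search is restricted are those whose head is not \<open>head G b\<close>, and \<open>c\<close>.
\<close>

definition singled_out ::
  "('a, 'b) pre_digraph \<Rightarrow> 'b set \<Rightarrow> 'b \<Rightarrow> 'b \<Rightarrow> 'b \<Rightarrow> bool" where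
  "singled_out G A a b c \<longleftrightarrow> a \<in> A \<and> b \<in> arcs G \<and> c \<in> arcs G \<and>
     (\<forall>x \<in> A. head G x \<noteq> head G b \<or> x = c) \<and>
     (\<forall>A'. cycset G A' \<longrightarrow> a \<in> A' \<longrightarrow> (\<forall>x \<in> A'. head G x \<noteq> head G b \<or> x = c) \<longrightarrow> A' \<subseteq> A)"

lemma cycset_succ: "cycset G A \<Longrightarrow> x \<in> A \<Longrightarrow> \<exists>y \<in> A. tail G y = head G x"
  unfolding cycset_def by (metis imageE imageI)

lemma cycset_pred: "cycset G A \<Longrightarrow> x \<in> A \<Longrightarrow> \<exists>y \<in> A. head G y = tail G x"
  unfolding cycset_def by (metis imageE imageI)

lemma cycset_tail_inj: "cycset G A \<Longrightarrow> x \<in> A \<Longrightarrow> y \<in> A \<Longrightarrow> tail G x = tail G y \<Longrightarrow> x = y"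
  unfolding cycset_def by (metis inj_onD)

lemma cycset_head_inj: "cycset G A \<Longrightarrow> x \<in> A \<Longrightarrow> y \<in> A \<Longrightarrow> head G x = head G y \<Longrightarrow> x = y"
  unfolding cycset_def by (metis inj_onD)

section \<open>Dicycles of a multiwheel\<close>

lemma rim_closed:
  assumes "Rim_arc m \<in> S" "m < p"
    and "\<And>m. m < p \<Longrightarrow> Rim_arc m \<in> S \<Longrightarrow> Rim_arc (Suc m mod p) \<in> S"
  shows "\<forall>i<p. Rim_arc i \<in> S"
proof -
  have *: "Rim_arc ((m + n) mod p) \<in> S" for n
  proof (induction n)
    case 0 then show ?case using assms by simp
  next
    case (Suc n)
    have "(m + n) mod p < p" using assms(2) by simp
    from assms(3)[OF this Suc] show ?case by (simp add: mod_Suc_eq)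
  qed
  show ?thesis
  proof (intro allI impI)
    fix i assume "i < p"
    have "(m + (p - m + i)) mod p = i" using \<open>m < p\<close> \<open>i < p\<close> by simp
    then show "Rim_arc i \<in> S" using *[of "p - m + i"] by simp
  qed
qed

lemma wheel_arc_cases:
  assumes "x \<in> arcs (wheel p l k)"
  obtains i where "x = Rim_arc i" "i < p" "tail (wheel p l k) x = Rim i"
      "head (wheel p l k) x = Rim (Suc i mod p)"
  | i j where "x = Out_spoke i j" "i < p" "tail (wheel p l k) x = Hub" "head (wheel p l k) x = Rim i"
  | i j where "x = In_spoke i j" "i < p" "tail (wheel p l k) x = Rim i" "head (wheel p l k) x = Hub"
  using assms by (auto simp: wheel_def)

lemma Suc_mod_inj:
  assumes "i < p" "j < p" "Suc i mod p = Suc j mod p"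
  shows "i = j"
  using assms by (auto simp: mod_Suc split: if_splits)

text \<open>Every tail in \<open>A\<close> is also a head in \<open>A\<close>, so a set that never
  enters the hub never leaves it. Only rim arcs remain, and these are closed under successors around
  the rim.\<close>

lemma wheel_rim_cycset:
  fixes p l k
  defines "W \<equiv> wheel p l k"
  assumes A: "cycset W A" and nohub: "\<forall>x \<in> A. head W x \<noteq> Hub"
  shows "A = Rim_arc ` {..<p}"
proof -
  have sub: "x \<in> arcs W" if "x \<in> A" for x using A that by (auto simp: cycset_def)
  have rim: "\<exists>i<p. x = Rim_arc i" if "x \<in> A" for x
    using sub[OF that] cycset_pred[OF A that] nohub that unfolding W_def
    by (auto elim!: wheel_arc_cases)
  obtain x where "x \<in> A" using A by (auto simp: cycset_def)
  with rim obtain m where m: "m < p" "Rim_arc m \<in> A" by blast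
  have "\<forall>i<p. Rim_arc i \<in> A"
  proof (rule rim_closed[OF m(2,1)])
    fix n assume n: "n < p" "Rim_arc n \<in> A"
    obtain y where y: "y \<in> A" "tail W y = head W (Rim_arc n)" using cycset_succ[OF A n(2)] by blast
    obtain i where "y = Rim_arc i" using rim[OF y(1)] by blast
    then show "Rim_arc (Suc n mod p) \<in> A" using y by (auto simp: W_def wheel_def)
  qed
  then show ?thesis using rim by blast
qed

lemma wheel_singled_out:
  fixes p l k
  defines "W \<equiv> wheel p l k"
  assumes A: "cycset W A"
  shows "\<exists>a b c. singled_out W A a b c"
proof (cases "\<forall>x \<in> A. head W x \<noteq> Hub")
  case True
  note Aeq = wheel_rim_cycset[OF A[unfolded W_def] True[unfolded W_def]]
  obtain a where a: "a \<in> A" using A by (auto simp: cycset_def)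
  have a_in: "a \<in> arcs W" using A a by (auto simp: cycset_def)
  show ?thesis
  proof (cases "\<exists>s \<in> arcs W. head W s = Hub")
    case True
    then obtain s where s: "s \<in> arcs W" "head W s = Hub" by blast
    \<comment> \<open>Any arc \<open>s\<close> into the hub serves to ban all arcs into the hub. The
      exception \<open>a\<close> is a rim arc and lets none of them through.\<close>
    have "singled_out W A a s a"
      unfolding singled_out_def
    proof (intro conjI allI impI ballI)
      show "head W x \<noteq> head W s \<or> x = a" if "x \<in> A" for x
        using \<open>\<forall>x \<in> A. head W x \<noteq> Hub\<close> that s by simp
      fix A' assume A': "cycset W A'" "a \<in> A'" "\<forall>x\<in>A'. head W x \<noteq> head W s \<or> x = a"
      have "\<forall>x \<in> A'. head W x \<noteq> Hub"
        using A'(3) \<open>\<forall>x \<in> A. head W x \<noteq> Hub\<close> a s by auto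
      from wheel_rim_cycset[OF A'(1)[unfolded W_def] this[unfolded W_def]]
      show "A' \<subseteq> A" using Aeq by simp
    qed (use a a_in s in auto)
    then show ?thesis by blast
  next
    case False
    \<comment> \<open>No arc of the wheel enters the hub, so every \<open>cycset\<close> is the rim.
      The triple only has to be harmless for \<open>A\<close>, which it is because heads in
      \<open>A\<close> are distinct.\<close>
    have "singled_out W A a a a"
      unfolding singled_out_def
    proof (intro conjI allI impI ballI)
      show "head W x \<noteq> head W a \<or> x = a" if "x \<in> A" for x
        using cycset_head_inj[OF A that a] by blast
      fix A' assume A': "cycset W A'" "a \<in> A'"
      have "\<forall>x \<in> A'. head W x \<noteq> Hub"
        using False A' by (auto simp: cycset_def)
      from wheel_rim_cycset[OF A'(1)[unfolded W_def] this[unfolded W_def]]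
      show "A' \<subseteq> A" using Aeq by simp
    qed (use a a_in in auto)
    then show ?thesis by blast
  qed
next
  case False
  then obtain b where b: "b \<in> A" "head W b = Hub" by blast
  then have b_in: "b \<in> arcs W" using A by (auto simp: cycset_def)
  obtain a where a: "a \<in> A" "tail W a = Hub" using cycset_succ[OF A b(1)] b by auto
  have "singled_out W A a b b"
    unfolding singled_out_def
  proof (intro conjI allI impI ballI)
    show "head W x \<noteq> head W b \<or> x = b" if "x \<in> A" for x
      using cycset_head_inj[OF A that b(1)] by blast
    fix A' assume A': "cycset W A'" "a \<in> A'" "\<forall>x\<in>A'. head W x \<noteq> head W b \<or> x = b"
    \<comment> \<open>To leave the hub along \<open>a\<close>, the set \<open>A'\<close> has to
      enter it, and \<open>b\<close> is the only arc left for that.\<close>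
    have bA': "b \<in> A'"
      using cycset_pred[OF A'(1,2)] A'(3) a(2) b(2) by auto
    have sub: "x \<in> arcs W" if "x \<in> A \<or> x \<in> A'" for x using A A' that by (auto simp: cycset_def)
    have hub_out: "x = a" if "x \<in> A'" "tail W x = Hub" for x
      using cycset_tail_inj[OF A'(1) that(1) A'(2)] that a by simp
    have hub_out': "x = a" if "x \<in> A" "tail W x = Hub" for x
      using cycset_tail_inj[OF A that(1) a(1)] that a by simp
    have hub_in: "x = b" if "x \<in> A'" "head W x = Hub" for x
      using A'(3) that b by auto
    \<comment> \<open>The only arcs of \<open>A'\<close> at the hub are \<open>a\<close> and
      \<open>b\<close>, and both belong to \<open>A\<close>; so \<open>A'\<close> can deviate from
      \<open>A\<close> only along the rim.\<close>
    have rim: "\<exists>m<p. x = Rim_arc m" if "x \<in> A' - A" for x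
    proof -
      have "x \<in> arcs W" "x \<noteq> a" "x \<noteq> b" using that sub a b by auto
      then show ?thesis using hub_out[of x] hub_in[of x] that
        unfolding W_def by (auto elim!: wheel_arc_cases)
    qed
    show "A' \<subseteq> A"
    proof (rule ccontr)
      assume "\<not> A' \<subseteq> A"
      then obtain x where "x \<in> A' - A" by blast
      with rim obtain m where m: "m < p" "Rim_arc m \<in> A' - A" by blast
      \<comment> \<open>A deviation never ends. If \<open>A\<close> left the vertex after
        \<open>Rim_arc n\<close>, it would also enter it, either by \<open>Rim_arc n\<close>, which
        is not in \<open>A\<close>, or by \<open>a\<close>; but \<open>a\<close> and
        \<open>Rim_arc n\<close> both lie in \<open>A'\<close> and cannot share a head.\<close>
      have all: "\<forall>i<p. Rim_arc i \<in> A' - A"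
      proof (rule rim_closed[OF m(2,1)])
        fix n assume n: "n < p" "Rim_arc n \<in> A' - A"
        have hn: "head W (Rim_arc n) = Rim (Suc n mod p)" by (simp add: W_def wheel_def)
        obtain y where y: "y \<in> A'" "tail W y = Rim (Suc n mod p)"
          using cycset_succ[OF A'(1), of "Rim_arc n"] n hn by auto
        have "y \<notin> A"
        proof
          assume "y \<in> A"
          then obtain z where z: "z \<in> A" "head W z = Rim (Suc n mod p)"
            using cycset_pred[OF A] y by metis
          have "z \<in> arcs W" using z sub by blast
          then show False unfolding W_def
          proof (cases rule: wheel_arc_cases)
            case (1 i)
            then show ?thesis using z n Suc_mod_inj[of i p n] by (auto simp: W_def)
          next
            case (2 i j)
            then have "z = a" using hub_out'[OF z(1)] by (simp add: W_def)
            then show ?thesis using cycset_head_inj[OF A'(1,2), of "Rim_arc n"] n z hn by auto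
          next
            case (3 i j)
            then show ?thesis using z by (auto simp: W_def)
          qed
        qed
        then obtain i where "i < p" "y = Rim_arc i" using rim[of y] y by blast
        then show "Rim_arc (Suc n mod p) \<in> A' - A"
          using y \<open>y \<notin> A\<close> by (auto simp: W_def wheel_def)
      qed
      \<comment> \<open>Now \<open>A'\<close> contains the whole rim and also the spoke
        \<open>b\<close>, so two of its arcs leave the tail of \<open>b\<close>.\<close>
      obtain j t where j: "j < p" "b = In_spoke j t" "tail W b = Rim j"
        using b_in b(2) unfolding W_def by (auto elim!: wheel_arc_cases)
      have "Rim_arc j \<in> A'" "tail W (Rim_arc j) = Rim j"
        using all j by (auto simp: W_def wheel_def)
      then show False using cycset_tail_inj[OF A'(1) bA', of "Rim_arc j"] j by auto
    qed
  qed (use a b b_in in auto)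
  then show ?thesis by blast
qed

section \<open>Split multiwheels, by contraction of the hub arc\<close>

lemma wheel_noHub:
  "x \<in> arcs (wheel p l k) \<Longrightarrow> x \<noteq> Hub_arc"
  "x \<in> arcs (wheel p l k) \<Longrightarrow> tail (wheel p l k) x \<in> insert Hub (range Rim)"
  "x \<in> arcs (wheel p l k) \<Longrightarrow> head (wheel p l k) x \<in> insert Hub (range Rim)"
  by (auto simp: wheel_def)

text \<open>\<open>Hub_arc\<close> is the only arc out of \<open>Hub_minus\<close> and the only arc
  into \<open>Hub_plus\<close>. A set that meets either of these vertices therefore uses it, and
  after contraction the set enters and leaves \<open>Hub\<close> equally often. The second claim
  recovers \<open>A\<close> from its contraction.\<close>

lemma cycset_split_hub:
  fixes p l k
  defines "W \<equiv> wheel p l k"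
  assumes A: "cycset (split_hub W) A"
  shows "cycset W (A - {Hub_arc})"
    and "Hub_arc \<in> A \<longleftrightarrow> (\<exists>x \<in> A - {Hub_arc}. tail W x = Hub)"
proof -
  let ?S = "split_hub W"
  have sub: "x \<in> arcs W" if "x \<in> A" "x \<noteq> Hub_arc" for x
    using A that by (auto simp: cycset_def split_hub_def)
  have t: "tail ?S x = (if tail W x = Hub then Hub_plus else tail W x)"
    and h: "head ?S x = (if head W x = Hub then Hub_minus else head W x)"
    if "x \<noteq> Hub_arc" for x using that by (auto simp: split_hub_def)
  have tH: "tail ?S Hub_arc = Hub_minus" "head ?S Hub_arc = Hub_plus"
    by (auto simp: split_hub_def)
  have nt: "tail W x \<noteq> Hub_minus" "tail W x \<noteq> Hub_plus" "head W x \<noteq> Hub_minus" "head W x \<noteq> Hub_plus"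
    if "x \<in> A" "x \<noteq> Hub_arc" for x
    using wheel_noHub(2,3)[of x p l k] sub[OF that] by (auto simp: W_def)
  have outp: "Hub_arc \<in> A" if x: "x \<in> A" "x \<noteq> Hub_arc" "tail W x = Hub" for x
  proof -
    obtain y where y: "y \<in> A" "head ?S y = Hub_plus"
      using cycset_pred[OF A x(1)] t[OF x(2)] x by auto
    then show ?thesis using h[of y] nt[of y] by (cases "y = Hub_arc") (auto split: if_splits)
  qed
  have inp: "Hub_arc \<in> A" if x: "x \<in> A" "x \<noteq> Hub_arc" "head W x = Hub" for x
  proof -
    obtain y where y: "y \<in> A" "tail ?S y = Hub_minus"
      using cycset_succ[OF A x(1)] h[OF x(2)] x by auto
    then show ?thesis using t[of y] nt[of y] by (cases "y = Hub_arc") (auto split: if_splits)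
  qed
  have ex_out: "\<exists>x \<in> A - {Hub_arc}. tail W x = Hub" if H: "Hub_arc \<in> A"
  proof -
    obtain y where y: "y \<in> A" "tail ?S y = Hub_plus"
      using cycset_succ[OF A H] tH by auto
    then show ?thesis using t[of y] nt[of y] tH by (cases "y = Hub_arc") (auto split: if_splits)
  qed
  have ex_in: "\<exists>x \<in> A - {Hub_arc}. head W x = Hub" if H: "Hub_arc \<in> A"
  proof -
    obtain y where y: "y \<in> A" "head ?S y = Hub_minus"
      using cycset_pred[OF A H] tH by auto
    then show ?thesis using h[of y] nt[of y] tH by (cases "y = Hub_arc") (auto split: if_splits)
  qed
  show "Hub_arc \<in> A \<longleftrightarrow> (\<exists>x \<in> A - {Hub_arc}. tail W x = Hub)"
    using outp ex_out by blast
  show "cycset W (A - {Hub_arc})"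
    unfolding cycset_def
  proof (intro conjI)
    show "A - {Hub_arc} \<subseteq> arcs W" using sub by blast
    show "A - {Hub_arc} \<noteq> {}" using A ex_out by (auto simp: cycset_def)
    show "inj_on (tail W) (A - {Hub_arc})"
      using cycset_tail_inj[OF A] t by (auto simp: inj_on_def)
    show "inj_on (head W) (A - {Hub_arc})"
      using cycset_head_inj[OF A] h by (auto simp: inj_on_def)
    show "tail W ` (A - {Hub_arc}) = head W ` (A - {Hub_arc})"
    proof (intro equalityI image_subsetI)
      fix x assume x: "x \<in> A - {Hub_arc}"
      show "tail W x \<in> head W ` (A - {Hub_arc})"
      proof (cases "tail W x = Hub")
        case True
        then show ?thesis using outp ex_in x by (metis DiffE imageI insertI1)
      next
        case False
        obtain y where y: "y \<in> A" "head ?S y = tail W x"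
          using cycset_pred[OF A, of x] x t[of x] False by auto
        then show ?thesis using tH nt[of x] x h[of y] by (cases "y = Hub_arc") (auto simp: image_iff intro!: bexI[of _ y] split: if_splits)
      qed
      show "head W x \<in> tail W ` (A - {Hub_arc})"
      proof (cases "head W x = Hub")
        case True
        then show ?thesis using inp ex_out x by (metis DiffE imageI insertI1)
      next
        case False
        obtain y where y: "y \<in> A" "tail ?S y = head W x"
          using cycset_succ[OF A, of x] x h[of x] False by auto
        then show ?thesis using tH nt[of x] x t[of y] by (cases "y = Hub_arc") (auto simp: image_iff intro!: bexI[of _ y] split: if_splits)
      qed
    qed
  qed
qed

text \<open>The triple of the contracted set still works. All arcs into \<open>Hub\<close> are
  redirected to the same vertex \<open>Hub_minus\<close>, so wheel arcs share a head after splitting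
  exactly if they did before, and \<open>Hub_arc\<close> is never deleted because it alone enters
  \<open>Hub_plus\<close>.\<close>

lemma split_wheel_singled_out:
  fixes p l k
  defines "W \<equiv> wheel p l k"
  assumes A: "cycset (split_hub W) A"
  shows "\<exists>a b c. singled_out (split_hub W) A a b c"
proof -
  note A1 = cycset_split_hub[OF A[unfolded W_def], folded W_def]
  obtain a b c where s: "singled_out W (A - {Hub_arc}) a b c"
    using wheel_singled_out[OF A1(1)[unfolded W_def]] unfolding W_def by blast
  have b: "b \<in> arcs W" "b \<noteq> Hub_arc" using s by (auto simp: singled_out_def W_def dest: wheel_noHub(1))
  have c: "c \<in> arcs W" using s by (auto simp: singled_out_def)
  have hb: "head W b \<noteq> Hub_plus" "head W b \<noteq> Hub_minus"
    using wheel_noHub(3)[of b p l k] b by (auto simp: W_def)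
  have heq: "head (split_hub W) x = head (split_hub W) b \<longleftrightarrow> head W x = head W b"
    if "x \<noteq> Hub_arc" "x \<in> arcs W" for x
    using that b hb wheel_noHub(3)[of x p l k] by (auto simp: W_def split_hub_def)
  have hub: "head (split_hub W) Hub_arc \<noteq> head (split_hub W) b"
    using b hb by (auto simp: split_hub_def)
  have sub: "x \<in> arcs W" if "x \<in> A'" "x \<noteq> Hub_arc" "cycset (split_hub W) A'" for x A'
    using that by (auto simp: cycset_def split_hub_def)
  have "singled_out (split_hub W) A a b c"
    unfolding singled_out_def
  proof (intro conjI allI impI ballI)
    show "a \<in> A" using s by (auto simp: singled_out_def)
    show "b \<in> arcs (split_hub W)" "c \<in> arcs (split_hub W)" using b c by (auto simp: split_hub_def)
    show "head (split_hub W) x \<noteq> head (split_hub W) b \<or> x = c" if "x \<in> A" for x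
      using s that hub heq[of x] sub[OF that _ A] by (auto simp: singled_out_def)
    fix A' assume A': "cycset (split_hub W) A'" "a \<in> A'"
      "\<forall>x\<in>A'. head (split_hub W) x \<noteq> head (split_hub W) b \<or> x = c"
    note A2 = cycset_split_hub[OF A'(1)[unfolded W_def], folded W_def]
    have "\<forall>x\<in>A' - {Hub_arc}. head W x \<noteq> head W b \<or> x = c"
      using A'(3) heq sub[OF _ _ A'(1)] by auto
    then have "A' - {Hub_arc} \<subseteq> A - {Hub_arc}"
      using s A2(1) A'(2) by (auto simp: singled_out_def)
    \<comment> \<open>If \<open>Hub_arc\<close> is in \<open>A'\<close>, then \<open>A'\<close> has
      an arc out of the hub. This arc lies in \<open>A\<close> by the inclusion just shown, and so
      \<open>Hub_arc\<close> is in \<open>A\<close>.\<close>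
    then show "A' \<subseteq> A" using A1(2) A2(2) by blast
  qed
  then show ?thesis by blast
qed

lemma multiwheel_singled_out:
  assumes "W \<in> multiwheels \<union> split_multiwheels" "cycset W A"
  shows "\<exists>a b c. singled_out W A a b c"
  using assms wheel_singled_out split_wheel_singled_out
  unfolding multiwheels_def split_multiwheels_def by blast

lemma multiwheel_wf:
  assumes "W \<in> multiwheels \<union> split_multiwheels"
  shows "wf_digraph W"
  using assms unfolding multiwheels_def split_multiwheels_def
  by (auto simp: wf_digraph_def wheel_def split_hub_def)

section \<open>Subdivisions\<close>

lemma internal_vert_nth:
  "Suc i < length q \<Longrightarrow> head H (q ! i) \<in> set (internal_verts H q)"
  by (auto simp: internal_verts_def nth_butlast[symmetric] intro!: imageI nth_mem)

lemma cas_nth: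
  "pre_digraph.cas H u q v \<Longrightarrow> Suc i < length q \<Longrightarrow> tail H (q ! Suc i) = head H (q ! i)"
proof (induction q arbitrary: u i)
  case Nil then show ?case by simp
next
  case (Cons x q)
  then show ?case
    by (cases i; cases q) (auto simp: pre_digraph.cas.simps)
qed

lemma cas_hd: "pre_digraph.cas H u q v \<Longrightarrow> q \<noteq> [] \<Longrightarrow> tail H (hd q) = u"
  by (cases q) (auto simp: pre_digraph.cas.simps)

lemma cas_last: "pre_digraph.cas H u q v \<Longrightarrow> q \<noteq> [] \<Longrightarrow> head H (last q) = v"
  by (induction q arbitrary: u) (auto simp: pre_digraph.cas.simps)

locale subdivided =
  fixes H :: "('a, 'b) pre_digraph" and W :: "('c, 'd) pre_digraph"
    and f :: "'c \<Rightarrow> 'a" and Q :: "'d \<Rightarrow> 'b list"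
  assumes wf: "wf_digraph W" and inj: "inj_on f (verts W)"
    and ne: "\<And>a. a \<in> arcs W \<Longrightarrow> Q a \<noteq> []"
    and walk: "\<And>a. a \<in> arcs W \<Longrightarrow> pre_digraph.awalk H (f (tail W a)) (Q a) (f (head W a))"
    and dist: "\<And>a. a \<in> arcs W \<Longrightarrow> distinct (internal_verts H (Q a))"
    and new: "\<And>a. a \<in> arcs W \<Longrightarrow> set (internal_verts H (Q a)) \<inter> f ` verts W = {}"
    and disj_arcs: "\<And>a b. a \<in> arcs W \<Longrightarrow> b \<in> arcs W \<Longrightarrow> a \<noteq> b \<Longrightarrow> set (Q a) \<inter> set (Q b) = {}"
    and disj_int: "\<And>a b. a \<in> arcs W \<Longrightarrow> b \<in> arcs W \<Longrightarrow> a \<noteq> b \<Longrightarrow>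
       set (internal_verts H (Q a)) \<inter> set (internal_verts H (Q b)) = {}"
    and arcs_eq: "arcs H = (\<Union>a \<in> arcs W. set (Q a))"
begin

lemma cas: "a \<in> arcs W \<Longrightarrow> pre_digraph.cas H (f (tail W a)) (Q a) (f (head W a))"
  using walk by (auto simp: pre_digraph.awalk_def)

lemmas tail_hd = cas_hd[OF cas ne] and head_last = cas_last[OF cas ne]

lemma ends_in: "a \<in> arcs W \<Longrightarrow> tail W a \<in> verts W" "a \<in> arcs W \<Longrightarrow> head W a \<in> verts W"
  using wf by (auto simp: wf_digraph_def)

lemma new_nth:
  "a \<in> arcs W \<Longrightarrow> Suc i < length (Q a) \<Longrightarrow> v \<in> verts W \<Longrightarrow> head H (Q a ! i) \<noteq> f v"
  using new[of a] internal_vert_nth[of i "Q a" H] by blast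

lemma head_cases:
  assumes "a \<in> arcs W" "x \<in> set (Q a)"
  obtains "x = last (Q a)" | i where "x = Q a ! i" "Suc i < length (Q a)"
  using assms by (metis Suc_lessI in_set_conv_nth last_conv_nth ne diff_Suc_1)

lemma tail_cases:
  assumes "a \<in> arcs W" "x \<in> set (Q a)"
  obtains "x = hd (Q a)" | i where "x = Q a ! Suc i" "Suc i < length (Q a)"
  using assms by (metis hd_conv_nth in_set_conv_nth ne not0_implies_Suc)

lemma head_branch:
  assumes "a \<in> arcs W" "x \<in> set (Q a)" "head H x = f v" "v \<in> verts W"
  shows "x = last (Q a)" "v = head W a"
proof -
  show x: "x = last (Q a)"
    using head_cases[OF assms(1,2)] new_nth[OF assms(1) _ assms(4)] assms(3) by metis
  show "v = head W a"
    using inj assms(3,4) head_last[OF assms(1) assms(1)] ends_in(2)[OF assms(1)] x by (metis inj_onD)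
qed

lemma tail_branch:
  assumes "a \<in> arcs W" "x \<in> set (Q a)" "tail H x = f v" "v \<in> verts W"
  shows "x = hd (Q a)" "v = tail W a"
proof -
  show x: "x = hd (Q a)"
    using tail_cases[OF assms(1,2)] new_nth[OF assms(1) _ assms(4)] cas_nth[OF cas[OF assms(1)]]
      assms(3) by metis
  show "v = tail W a"
    using inj assms(3,4) tail_hd[OF assms(1) assms(1)] ends_in(1)[OF assms(1)] x by (metis inj_onD)
qed

lemma int_inj:
  assumes "a \<in> arcs W" "b \<in> arcs W" "Suc i < length (Q a)" "Suc j < length (Q b)"
    "head H (Q a ! i) = head H (Q b ! j)"
  shows "a = b" "i = j"
proof -
  show ab: "a = b"
    using disj_int[OF assms(1,2)] internal_vert_nth[OF assms(3), of H]
      internal_vert_nth[OF assms(4), of H] assms(5) by auto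
  have "i < length (butlast (Q a))" "j < length (butlast (Q a))" using assms ab by auto
  then show "i = j"
    using nth_eq_iff_index_eq[OF dist[OF assms(1)], of i j] assms(5) ab
    by (simp add: internal_verts_def nth_butlast)
qed

lemma arc_cover: "cycset H B \<Longrightarrow> x \<in> B \<Longrightarrow> \<exists>a \<in> arcs W. x \<in> set (Q a)"
  unfolding cycset_def arcs_eq by blast

text \<open>An internal vertex has only one arc out of it: an arc that starts a path leaves a branch
  vertex, and \<open>int_inj\<close> excludes any other position on any path.\<close>

lemma step_forward:
  assumes B: "cycset H B" and a: "a \<in> arcs W" "Suc i < length (Q a)" "Q a ! i \<in> B"
  shows "Q a ! Suc i \<in> B"
proof -
  obtain z where z: "z \<in> B" "tail H z = head H (Q a ! i)" using cycset_succ[OF B a(3)] by blast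
  obtain c where c: "c \<in> arcs W" "z \<in> set (Q c)" using arc_cover[OF B] z by blast
  show ?thesis
  proof (rule tail_cases[OF c])
    assume "z = hd (Q c)"
    then show ?thesis using tail_hd[OF c(1) c(1)] z new_nth[OF a(1,2) ends_in(1)[OF c(1)]] by simp
  next
    fix j assume j: "z = Q c ! Suc j" "Suc j < length (Q c)"
    then show ?thesis
      using int_inj[OF a(1) c(1) a(2) j(2)] z cas_nth[OF cas[OF c(1)] j(2)] by simp
  qed
qed

lemma step_back:
  assumes B: "cycset H B" and a: "a \<in> arcs W" "Suc i < length (Q a)" "Q a ! Suc i \<in> B"
  shows "Q a ! i \<in> B"
proof -
  have t: "tail H (Q a ! Suc i) = head H (Q a ! i)" using cas_nth[OF cas[OF a(1)] a(2)] .
  obtain z where z: "z \<in> B" "head H z = head H (Q a ! i)" using cycset_pred[OF B a(3)] t by auto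
  obtain c where c: "c \<in> arcs W" "z \<in> set (Q c)" using arc_cover[OF B] z by blast
  show ?thesis
  proof (rule head_cases[OF c])
    assume "z = last (Q c)"
    then show ?thesis using head_last[OF c(1) c(1)] z new_nth[OF a(1,2) ends_in(2)[OF c(1)]] by simp
  next
    fix j assume j: "z = Q c ! j" "Suc j < length (Q c)"
    then show ?thesis
      using int_inj[OF a(1) c(1) a(2) j(2)] z by simp
  qed
qed

lemma whole_path:
  assumes B: "cycset H B" and a: "a \<in> arcs W" "x \<in> set (Q a)" "x \<in> B"
  shows "set (Q a) \<subseteq> B"
proof -
  obtain i where i: "i < length (Q a)" "Q a ! i \<in> B" using a by (auto simp: in_set_conv_nth)
  \<comment> \<open>Subtraction is truncated, so the induction simply stays at position 0 once it
    has arrived there.\<close>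
  have down: "Q a ! (i - n) \<in> B" for n
  proof (induction n)
    case (Suc n)
    show ?case
    proof (cases "i - n")
      case 0 then show ?thesis using Suc by simp
    next
      case (Suc m)
      show ?thesis
      proof -
        have "Q a ! m \<in> B" using step_back[OF B a(1), of m] Suc.IH i \<open>i - n = Suc m\<close> by simp
        moreover have "i - Suc n = m" using \<open>i - n = Suc m\<close> by simp
        ultimately show ?thesis by simp
      qed
    qed
  qed (use i in simp)
  have up: "i + n < length (Q a) \<Longrightarrow> Q a ! (i + n) \<in> B" for n
    by (induction n) (use i step_forward[OF B a(1)] in auto)
  have "Q a ! j \<in> B" if "j < length (Q a)" for j
    using down[of "i - j"] up[of "j - i"] that by (cases "j \<le> i") auto
  then show ?thesis by (auto simp: in_set_conv_nth)
qed

text \<open>For a \<open>cycset\<close>, one arc of the path would be enough, by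
  \<open>whole_path\<close>.\<close>

definition traversed :: "'b set \<Rightarrow> 'd set" where
  "traversed B = {a \<in> arcs W. set (Q a) \<subseteq> B}"

lemma traversedI: "cycset H B \<Longrightarrow> a \<in> arcs W \<Longrightarrow> x \<in> set (Q a) \<Longrightarrow> x \<in> B \<Longrightarrow> a \<in> traversed B"
  using whole_path by (auto simp: traversed_def)

lemma hd_traversed: "a \<in> traversed B \<Longrightarrow> hd (Q a) \<in> B"
  and last_traversed: "a \<in> traversed B \<Longrightarrow> last (Q a) \<in> B"
  using ne by (auto simp: traversed_def)

lemma traversed_arcs: "a \<in> traversed B \<Longrightarrow> a \<in> arcs W"
  by (simp add: traversed_def)

lemma traversed_covers:
  assumes B: "cycset H B"
  shows "B = (\<Union>a \<in> traversed B. set (Q a))"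
proof
  show "B \<subseteq> (\<Union>a \<in> traversed B. set (Q a))"
  proof
    fix x assume "x \<in> B"
    moreover then obtain a where "a \<in> arcs W" "x \<in> set (Q a)"
      using arc_cover[OF B] by blast
    ultimately show "x \<in> (\<Union>a \<in> traversed B. set (Q a))" using traversedI[OF B] by blast
  qed
qed (auto simp: traversed_def)

lemma path_unique: "a \<in> arcs W \<Longrightarrow> b \<in> arcs W \<Longrightarrow> x \<in> set (Q a) \<Longrightarrow> x \<in> set (Q b) \<Longrightarrow> a = b"
  using disj_arcs by blast

lemma hd_in: "a \<in> arcs W \<Longrightarrow> hd (Q a) \<in> set (Q a)" and last_in: "a \<in> arcs W \<Longrightarrow> last (Q a) \<in> set (Q a)"
  using ne by auto

text \<open>The ends of \<open>a\<close> in \<open>W\<close> are the tail of the first and the head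
  of the last arc of \<open>Q a\<close>. Conversely an arc of \<open>B\<close> at a branch vertex is
  the first or last arc of its path, so the balance of \<open>B\<close> at branch vertices becomes
  that of \<open>traversed B\<close>.\<close>

lemma cycset_traversed:
  assumes B: "cycset H B"
  shows "cycset W (traversed B)"
  unfolding cycset_def
proof (intro conjI)
  note A = traversed_arcs[of _ B]
  show "traversed B \<subseteq> arcs W" using A by blast
  show "traversed B \<noteq> {}"
  proof
    assume "traversed B = {}"
    then have "B = {}" using traversed_covers[OF B] by simp
    then show False using B by (simp add: cycset_def)
  qed
  show "inj_on (tail W) (traversed B)"
  proof (rule inj_onI)
    fix a b assume ab: "a \<in> traversed B" "b \<in> traversed B" "tail W a = tail W b"
    have "tail H (hd (Q a)) = tail H (hd (Q b))"
      using tail_hd[OF A A, OF ab(1) ab(1)] tail_hd[OF A A, OF ab(2) ab(2)] ab(3) by simp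
    then have "hd (Q a) = hd (Q b)"
      by (rule cycset_tail_inj[OF B hd_traversed hd_traversed, OF ab(1,2)])
    then show "a = b" using path_unique[OF A[OF ab(1)] A[OF ab(2)] hd_in[OF A[OF ab(1)]]]
        hd_in[OF A[OF ab(2)]] by simp
  qed
  show "inj_on (head W) (traversed B)"
  proof (rule inj_onI)
    fix a b assume ab: "a \<in> traversed B" "b \<in> traversed B" "head W a = head W b"
    have "head H (last (Q a)) = head H (last (Q b))"
      using head_last[OF A A, OF ab(1) ab(1)] head_last[OF A A, OF ab(2) ab(2)] ab(3) by simp
    then have "last (Q a) = last (Q b)"
      by (rule cycset_head_inj[OF B last_traversed last_traversed, OF ab(1,2)])
    then show "a = b" using path_unique[OF A[OF ab(1)] A[OF ab(2)] last_in[OF A[OF ab(1)]]]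
        last_in[OF A[OF ab(2)]] by simp
  qed
  show "tail W ` traversed B = head W ` traversed B"
  proof (intro equalityI image_subsetI)
    fix a assume a: "a \<in> traversed B"
    obtain x where x: "x \<in> B" "head H x = f (tail W a)"
      using cycset_pred[OF B hd_traversed[OF a]] tail_hd[OF A[OF a] A[OF a]] by auto
    obtain c where c: "c \<in> arcs W" "x \<in> set (Q c)" using arc_cover[OF B] x by blast
    have "tail W a = head W c" using head_branch(2)[OF c x(2) ends_in(1)[OF A[OF a]]] .
    then show "tail W a \<in> head W ` traversed B" using traversedI[OF B c x(1)] by blast
  next
    fix a assume a: "a \<in> traversed B"
    obtain x where x: "x \<in> B" "tail H x = f (head W a)"
      using cycset_succ[OF B last_traversed[OF a]] head_last[OF A[OF a] A[OF a]] by auto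
    obtain c where c: "c \<in> arcs W" "x \<in> set (Q c)" using arc_cover[OF B] x by blast
    have "head W a = tail W c" using tail_branch(2)[OF c x(2) ends_in(2)[OF A[OF a]]] .
    then show "head W a \<in> tail W ` traversed B" using traversedI[OF B c x(1)] by blast
  qed
qed

text \<open>The arcs into a branch vertex are last arcs of paths, hence \<open>last\<close> for
  \<open>b\<close> and \<open>c\<close>. For \<open>a\<close> any arc of its path would do, since a
  \<open>cycset\<close> contains the whole path or nothing of it.\<close>

lemma singled_out_subdivided:
  assumes B: "cycset H B" and s: "singled_out W (traversed B) a b c"
  shows "singled_out H B (hd (Q a)) (last (Q b)) (last (Q c))"
proof -
  have a: "a \<in> traversed B" and bc: "b \<in> arcs W" "c \<in> arcs W" using s by (auto simp: singled_out_def)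
  have hb: "head H (last (Q b)) = f (head W b)" using head_last bc by blast
  show ?thesis
    unfolding singled_out_def
  proof (intro conjI allI impI ballI)
    show "hd (Q a) \<in> B" using hd_traversed a by blast
    show "last (Q b) \<in> arcs H" "last (Q c) \<in> arcs H" using arcs_eq bc last_in by auto
    fix x assume x: "x \<in> B"
    obtain d where d: "d \<in> arcs W" "x \<in> set (Q d)" using arc_cover[OF B] x by blast
    have "x = last (Q c)" if h: "head H x = head H (last (Q b))"
    proof -
      note hx = head_branch[OF d h[unfolded hb] ends_in(2)[OF bc(1)]]
      have "d = c" using s traversedI[OF B d x] hx by (auto simp: singled_out_def)
      then show ?thesis using hx by simp
    qed
    then show "head H x \<noteq> head H (last (Q b)) \<or> x = last (Q c)" by blast
  next
    fix B' assume B': "cycset H B'" "hd (Q a) \<in> B'"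
      "\<forall>x\<in>B'. head H x \<noteq> head H (last (Q b)) \<or> x = last (Q c)"
    have "a \<in> traversed B'" using traversedI[OF B'(1) _ hd_in B'(2)] traversed_arcs[OF a] by blast
    moreover have "head W d \<noteq> head W b \<or> d = c" if d: "d \<in> traversed B'" for d
    proof -
      note dA = traversed_arcs[OF d]
      have "d = c" if "head W d = head W b"
      proof -
        have "last (Q d) = last (Q c)"
          using B'(3) last_traversed[OF d] head_last[OF dA dA] hb that by auto
        then show ?thesis using path_unique[OF dA bc(2)] last_in[OF dA] last_in[OF bc(2)] by metis
      qed
      then show ?thesis by blast
    qed
    ultimately have "traversed B' \<subseteq> traversed B"
      using s cycset_traversed[OF B'(1)] by (auto simp: singled_out_def)
    then have "(\<Union>a \<in> traversed B'. set (Q a)) \<subseteq> (\<Union>a \<in> traversed B. set (Q a))" by blast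
    then show "B' \<subseteq> B"
      by (simp only: traversed_covers[OF B, symmetric] traversed_covers[OF B'(1), symmetric])
  qed
qed

end

lemma subdivided_multiwheel_singled_out:
  assumes "W \<in> multiwheels \<union> split_multiwheels" "subdivision_of H W" "cycset H B"
  shows "\<exists>a b c. singled_out H B a b c"
  using assms(2) unfolding subdivision_of_def
proof (elim exE conjE)
  fix f Q
  assume inj: "inj_on f (verts W)"
    and Q: "\<forall>a\<in>arcs W. Q a \<noteq> [] \<and> pre_digraph.awalk H (f (tail W a)) (Q a) (f (head W a)) \<and>
        distinct (internal_verts H (Q a)) \<and> set (internal_verts H (Q a)) \<inter> f ` verts W = {}"
    and disj: "\<forall>a\<in>arcs W. \<forall>b\<in>arcs W. a \<noteq> b \<longrightarrow> set (Q a) \<inter> set (Q b) = {} \<and>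
        set (internal_verts H (Q a)) \<inter> set (internal_verts H (Q b)) = {}"
    and arcs: "arcs H = (\<Union>a\<in>arcs W. set (Q a))"
  interpret subdivided H W f Q
    by (rule subdivided.intro[OF multiwheel_wf[OF assms(1)] inj _ _ _ _ _ _ arcs]) (simp_all add: Q disj)
  show ?thesis
    using multiwheel_singled_out[OF assms(1) cycset_traversed[OF assms(3)]]
      singled_out_subdivided[OF assms(3)] by blast
qed

section \<open>Dicycles of a general digraph and the nontrivial strong component\<close>

lemma (in wf_digraph) cycle_heads:
  assumes "cycle p"
  shows "distinct (map (head G) p)" "tail G ` set p = head G ` set p" "p \<noteq> []" "set p \<subseteq> arcs G"
    and "\<exists>u. awalk u p u"
proof -
  from assms obtain u where u: "awalk u p u" "distinct (tl (awalk_verts u p))" "p \<noteq> []"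
    by (auto simp: cycle_def)
  show "p \<noteq> []" "set p \<subseteq> arcs G" "\<exists>u. awalk u p u" using u by auto
  have c: "cas u p u" using u by auto
  show "distinct (map (head G) p)" using u by (simp add: awalk_verts_conv'[OF c])
  \<comment> \<open>Both sides list the vertices of the closed walk, which starts and ends at
    \<open>u\<close>.\<close>
  have "map (tail G) p @ [u] = u # map (head G) p"
    using awalk_verts_conv[of u p] awalk_verts_conv'[OF c] cas_last[OF c] cas_hd[OF c] u by simp
  then have "insert u (set (map (tail G) p)) = insert u (set (map (head G) p))"
    by (metis list.simps(15) rotate1.simps(2) set_rotate1)
  moreover have "u \<in> set (map (tail G) p)" "u \<in> set (map (head G) p)"
    using cas_last[OF c] cas_hd[OF c] u by (metis image_eqI last_in_set hd_in_set list.set_map)+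
  ultimately show "tail G ` set p = head G ` set p" by (simp add: insert_absorb)
qed

text \<open>The definition of \<open>cycle\<close> makes the heads distinct. The tails form the same
  set, which has as many elements as there are arcs, so no tail is repeated either.\<close>

lemma (in wf_digraph) cycset_cycle:
  assumes "cycle p"
  shows "cycset G (set p)"
proof -
  note h = cycle_heads[OF assms]
  have "card (tail G ` set p) = card (set p)"
    using h(1,2) by (metis card_image distinct_map)
  then have "inj_on (tail G) (set p)" by (intro eq_card_imp_inj_on) auto
  then show ?thesis using h by (auto simp: cycset_def distinct_map)
qed

text \<open>An arc just before the loop would share its head. Hence the walk starts at the loop, and
  if arcs followed, the last of them would return there and again share its head.\<close>

lemma (in wf_digraph) cycle_loop:
  assumes "cycle p" "a \<in> set p" "tail G a = head G a"
  shows "set p = {a}"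
proof -
  obtain u where u: "awalk u p u" using cycle_heads(5)[OF assms(1)] by blast
  obtain xs ys where p: "p = xs @ a # ys" using assms(2) by (meson split_list)
  have d: "distinct (map (head G) (xs @ a # ys))" using cycle_heads(1)[OF assms(1)] p by simp
  have c: "cas u xs (tail G a)" "cas (head G a) ys u" using u p by (auto simp: awalk_def)
  have "xs = []"
  proof (rule ccontr)
    assume "xs \<noteq> []"
    then have "head G a \<in> head G ` set xs" using cas_last[OF c(1)] assms(3) by (metis image_eqI last_in_set)
    then show False using d by auto
  qed
  then have "u = head G a" using c(1) assms(3) by simp
  have "ys = []"
  proof (rule ccontr)
    assume "ys \<noteq> []"
    then have "head G a \<in> head G ` set ys" using cas_last[OF c(2)] \<open>u = head G a\<close> by (metis image_eqI last_in_set)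
    then show False using d by auto
  qed
  then show ?thesis using p \<open>xs = []\<close> by simp
qed

lemma (in wf_digraph) cycle_mutually_reachable:
  assumes "cycle p" "x \<in> set p" "y \<in> set p"
  shows "head G x \<rightarrow>\<^sup>* head G y"
proof -
  obtain u where u: "awalk u p u" using cycle_heads(5)[OF assms(1)] by blast
  have *: "u \<rightarrow>\<^sup>* head G x \<and> head G x \<rightarrow>\<^sup>* u" if x: "x \<in> set p" for x
  proof -
    obtain xs ys where p: "p = xs @ x # ys" using x by (meson split_list)
    have "awalk u ((xs @ [x]) @ ys) u" using u p by simp
    moreover have "awlast u (xs @ [x]) = head G x" by (simp add: awalk_verts_conv)
    ultimately have "awalk u (xs @ [x]) (head G x)" "awalk (head G x) ys u"
      by (simp_all only: awalk_append_iff)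
    then show ?thesis by (blast intro: reachable_awalkI)
  qed
  show ?thesis using * assms reachable_trans by metis
qed

text \<open>The vertices of a dicycle are mutually reachable. If there are two of them, their strong
  component is nontrivial and can only be \<open>H\<close>, which as an induced subgraph contains
  all arcs between them.\<close>

lemma (in fin_digraph) cycle_in_nontrivial_scc:
  assumes H: "{H' \<in> sccs. 1 < card (verts H')} = {H}"
    and c: "cycle p" and e: "e \<in> set p" "tail G e \<noteq> head G e"
  shows "set p \<subseteq> arcs H"
proof -
  let ?S = "scc_of (head G e)"
  have e_in: "e \<in> arcs G" using cycle_heads(4)[OF c] e by blast
  have ends: "head G x \<in> ?S \<and> tail G x \<in> ?S" if "x \<in> set p" for x
  proof -
    have "tail G x \<in> head G ` set p" unfolding cycle_heads(2)[OF c, symmetric] using that by simp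
    then obtain y where y: "y \<in> set p" "tail G x = head G y" by blast
    show ?thesis using cycle_mutually_reachable[OF c] y e(1) that unfolding scc_of_def by auto
  qed
  have "G \<restriction> ?S \<in> sccs"
    using e_in by (intro in_verts_sccsD_sccs scc_of_in_sccs_verts) auto
  moreover have "1 < card (verts (G \<restriction> ?S))"
  proof -
    have "?S \<subseteq> verts G" by (auto simp: scc_of_def dest: reachable_in_verts)
    then have "finite ?S" using finite_verts finite_subset by blast
    moreover have "{tail G e, head G e} \<subseteq> ?S" using ends e by auto
    ultimately have "card {tail G e, head G e} \<le> card ?S" by (intro card_mono)
    then show ?thesis using e by simp
  qed
  ultimately have "G \<restriction> ?S \<in> {H' \<in> sccs. 1 < card (verts H')}" by simp
  then have "H = G \<restriction> ?S" unfolding H by simp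
  then show ?thesis using ends cycle_heads(4)[OF c] by (auto simp: induce_subgraph_def)
qed

lemma singled_outD:
  "singled_out G A a b c \<Longrightarrow> cycset G A' \<Longrightarrow> a \<in> A' \<Longrightarrow>
    (\<forall>x \<in> A'. head G x \<noteq> head G b \<or> x = c) \<Longrightarrow> A' \<subseteq> A"
  by (simp add: singled_out_def)

theorem (in fin_digraph) dicycle_singled_out:
  assumes "unique_nontrivial_scc_subdivided_multiwheel G" and c: "cycle B"
  shows "\<exists>a b c. a \<in> set B \<and> b \<in> arcs G \<and> c \<in> arcs G \<and> (\<forall>x \<in> set B. head G x \<noteq> head G b \<or> x = c) \<and>
     (\<forall>B'. cycle B' \<longrightarrow> a \<in> set B' \<longrightarrow> (\<forall>x \<in> set B'. head G x \<noteq> head G b \<or> x = c) \<longrightarrow> set B' \<subseteq> set B)"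
proof (cases "\<exists>a \<in> set B. tail G a = head G a")
  case True
  then obtain a where a: "a \<in> set B" "tail G a = head G a" by blast
  then have "set B = {a}" "a \<in> arcs G" using cycle_loop[OF c] cycle_heads(4)[OF c] by auto
  \<comment> \<open>A loop serves as all three arcs of its triple, because it is the only dicycle
    through itself.\<close>
  then show ?thesis using cycle_loop a by (intro exI[of _ a]) auto
next
  case False
  from assms(1) obtain H W where HW: "{H' \<in> sccs. 1 < card (verts H')} = {H}"
    "W \<in> multiwheels \<union> split_multiwheels" "subdivision_of H W"
    unfolding unique_nontrivial_scc_subdivided_multiwheel_def by blast
  have ind: "induced_subgraph H G" using HW(1) by (blast intro: in_sccs_imp_induced)
  then have H: "tail H = tail G" "head H = head G" "arcs H \<subseteq> arcs G"
    by (auto simp: induced_subgraph_def subgraph_def compatible_def)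
  have cyc: "cycset H (set p)" if "cycle p" "e \<in> set p" "tail G e \<noteq> head G e" for p e
    using cycset_cycle[OF that(1)] cycle_in_nontrivial_scc[OF HW(1) that(1,2,3)] H
    by (auto simp: cycset_def)
  obtain e where "e \<in> set B" using cycle_heads(3)[OF c] by fastforce
  then have "cycset H (set B)" using cyc[OF c] False by blast
  then obtain a b d where s: "singled_out H (set B) a b d"
    using subdivided_multiwheel_singled_out[OF HW(2,3)] by blast
  then have "a \<in> set B" and "b \<in> arcs H" "d \<in> arcs H" by (simp_all add: singled_out_def)
  then have a: "a \<in> set B" "tail G a \<noteq> head G a" and bd: "b \<in> arcs G" "d \<in> arcs G"
    using False H(3) by blast+
  have B: "\<forall>x \<in> set B. head G x \<noteq> head G b \<or> x = d"
    using s unfolding singled_out_def H(2) by blast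
  \<comment> \<open>Since \<open>a\<close> is not a loop, every competitor \<open>B'\<close> through
    \<open>a\<close> lies in \<open>H\<close> as well, where \<open>singled_out\<close> applies to
    it.\<close>
  have "set B' \<subseteq> set B"
    if "cycle B'" "a \<in> set B'" "\<forall>x \<in> set B'. head G x \<noteq> head G b \<or> x = d" for B'
    using singled_outD[OF s cyc[OF that(1,2) a(2)] that(2)] that(3) H(2) by simp
  then show ?thesis using a(1) bd B by blast
qed

section \<open>Search for a disjoint dicycle and cycle\<close>

text \<open>An arc is stored as (tail, head, label).\<close>

type_synonym larc = "nat \<times> nat \<times> nat"

abbreviation atail :: "larc \<Rightarrow> nat" where "atail x \<equiv> fst x"
abbreviation ahead :: "larc \<Rightarrow> nat" where "ahead x \<equiv> fst (snd x)"
abbreviation alabel :: "larc \<Rightarrow> nat" where "alabel x \<equiv> snd (snd x)"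

fun number_arcs :: "nat \<Rightarrow> (nat \<times> nat) list \<Rightarrow> larc list" where
  "number_arcs k [] = []"
| "number_arcs k (a # as) = (fst a, snd a, k) # number_arcs (Suc k) as"

text \<open>Polymorphic, because it serves both search states, keyed by vertices, and arc lists,
  where it asks whether a vertex is a tail. It returns the whole entry: the encoding of a pair is
  never \<open>Leaf\<close>, while that of an empty path is, and would look like failure.\<close>

primrec lookup :: "nat \<Rightarrow> (nat \<times> 'a) list \<Rightarrow> (nat \<times> 'a) option" where
  "lookup u [] = None"
| "lookup u (e # S) = (if u = fst e then Some e else lookup u S)"

definition extend :: "larc \<Rightarrow> (nat \<times> larc list) list \<Rightarrow> (nat \<times> larc list) list" where
  "extend x S = (case lookup (atail x) S of Some e \<Rightarrow> S
     | None \<Rightarrow> (case lookup (ahead x) S of None \<Rightarrow> S | Some e \<Rightarrow> (atail x, x # snd e) # S))"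

primrec pass :: "larc list \<Rightarrow> (nat \<times> larc list) list \<Rightarrow> (nat \<times> larc list) list" where
  "pass [] S = S"
| "pass (x # A) S = extend x (pass A S)"

text \<open>Breadth-first search backwards from the target; the first list only counts the rounds.\<close>

primrec rounds :: "'a list \<Rightarrow> larc list \<Rightarrow> (nat \<times> larc list) list \<Rightarrow> (nat \<times> larc list) list" where
  "rounds [] A S = S"
| "rounds (y # F) A S = pass A (rounds F A S)"

definition search :: "larc list \<Rightarrow> nat \<Rightarrow> nat \<Rightarrow> (nat \<times> larc list) option" where
  "search A s t = lookup s (rounds A A [(t, [])])"

fun walk :: "larc set \<Rightarrow> nat \<Rightarrow> larc list \<Rightarrow> nat \<Rightarrow> bool" where
  "walk A s [] t \<longleftrightarrow> s = t"
| "walk A s (x # p) t \<longleftrightarrow> x \<in> A \<and> atail x = s \<and> walk A (ahead x) p t"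

section \<open>Soundness, completeness and output length of the search\<close>

lemma walk_arcs: "walk A s p t \<Longrightarrow> set p \<subseteq> A"
  by (induction p arbitrary: s) auto

lemma walk_mono: "walk A s p t \<Longrightarrow> set p \<subseteq> A' \<Longrightarrow> walk A' s p t"
  by (induction p arbitrary: s) auto

lemma walk_append: "walk A s (p @ q) t \<longleftrightarrow> (\<exists>u. walk A s p u \<and> walk A u q t)"
  by (induction p arbitrary: s) auto

lemma lookup_Some: "lookup u S = Some e \<Longrightarrow> e \<in> set S \<and> fst e = u"
  by (induction S) (auto split: if_splits)

lemma lookup_None: "lookup u S = None \<longleftrightarrow> u \<notin> fst ` set S"
  by (induction S) auto

text \<open>An invariant. All vertices of the stored paths are keys, so a vertex that becomes a new
  key lies on none of them, and prepending it keeps the path simple. The bound on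
  \<open>length p\<close> is there for the running time.\<close>

definition paths_to :: "larc set \<Rightarrow> nat \<Rightarrow> (nat \<times> larc list) list \<Rightarrow> bool" where
  "paths_to A t S \<longleftrightarrow> (\<forall>(u, p) \<in> set S. walk A u p t \<and> distinct (map fst p @ [t]) \<and>
     set (map fst p @ [t]) \<subseteq> fst ` set S \<and> length p < length S)"

lemma extend_paths:
  assumes "paths_to A t S" "x \<in> A"
  shows "paths_to A t (extend x S)"
proof (cases "lookup (atail x) S = None \<and> lookup (ahead x) S \<noteq> None")
  case True
  then obtain e where e: "lookup (ahead x) S = Some e" by blast
  then have x: "extend x S = (atail x, x # snd e) # S" using True by (simp add: extend_def)
  have new: "atail x \<notin> fst ` set S" using True by (simp add: lookup_None)
  have "(ahead x, snd e) \<in> set S" using lookup_Some[OF e] by (metis prod.collapse)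
  then have p: "walk A (ahead x) (snd e) t" "distinct (map fst (snd e) @ [t])"
    "set (map fst (snd e) @ [t]) \<subseteq> fst ` set S" "length (snd e) < length S"
    using assms(1) unfolding paths_to_def by blast+
  show ?thesis
    unfolding x paths_to_def
  proof (intro ballI, clarify)
    fix u p assume "(u, p) \<in> set ((atail x, x # snd e) # S)"
    then consider "u = atail x" "p = x # snd e" | "(u, p) \<in> set S" by auto
    then show "walk A u p t \<and> distinct (map fst p @ [t]) \<and>
      set (map fst p @ [t]) \<subseteq> fst ` set ((atail x, x # snd e) # S) \<and>
      length p < length ((atail x, x # snd e) # S)"
    proof cases
      case 1
      then show ?thesis using p new assms(2) by auto
    next
      case 2
      then have "walk A u p t \<and> distinct (map fst p @ [t]) \<and>
        set (map fst p @ [t]) \<subseteq> fst ` set S \<and> length p < length S"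
        using assms(1) unfolding paths_to_def by blast
      then show ?thesis by auto
    qed
  qed
next
  case False
  then have "extend x S = S" by (auto simp: extend_def split: option.splits)
  then show ?thesis using assms by simp
qed

lemma extend_keys: "fst ` set S \<subseteq> fst ` set (extend x S)"
  by (auto simp: extend_def split: option.splits)

lemma extend_reaches: "ahead x \<in> fst ` set S \<Longrightarrow> atail x \<in> fst ` set (extend x S)"
  using lookup_None[of "ahead x" S] lookup_None[of "atail x" S]
  by (auto simp: extend_def split: option.splits)

lemma extend_length: "length (extend x S) \<le> Suc (length S)"
  by (auto simp: extend_def split: option.splits)

lemma pass_paths: "paths_to A t S \<Longrightarrow> set B \<subseteq> A \<Longrightarrow> paths_to A t (pass B S)"
  by (induction B) (auto intro: extend_paths)

lemma pass_keys: "fst ` set S \<subseteq> fst ` set (pass B S)"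
proof (induction B)
  case (Cons x B)
  then show ?case using extend_keys[of "pass B S" x] by simp
qed simp

text \<open>Keys are never lost, so each arc finds at least the keys from before the pass, whatever
  its position in the list.\<close>

lemma pass_reaches: "x \<in> set B \<Longrightarrow> ahead x \<in> fst ` set S \<Longrightarrow> atail x \<in> fst ` set (pass B S)"
proof (induction B)
  case (Cons y B)
  show ?case
  proof (cases "x = y")
    case True
    have "ahead y \<in> fst ` set (pass B S)" using pass_keys Cons.prems True by blast
    then show ?thesis using extend_reaches True by simp
  next
    case False
    then have "atail x \<in> fst ` set (pass B S)" using Cons by auto
    then show ?thesis using extend_keys[of "pass B S" y] by auto
  qed
qed simp

lemma pass_length: "length (pass B S) \<le> length B + length S"
proof (induction B)
  case (Cons x B)
  then show ?case using extend_length[of x "pass B S"] by simp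
qed simp

lemma rounds_paths: "paths_to (set A) t S \<Longrightarrow> paths_to (set A) t (rounds F A S)"
  by (induction F) (auto intro: pass_paths)

lemma rounds_length: "length (rounds F A S) \<le> length F * length A + length S"
proof (induction F)
  case (Cons x F)
  then show ?case using pass_length[of A "rounds F A S"] by simp
qed simp

lemma rounds_reaches:
  "walk (set A) s p t \<Longrightarrow> length p \<le> length F \<Longrightarrow> s \<in> fst ` set (rounds F A [(t, [])])"
proof (induction F arbitrary: s p)
  case (Cons y F)
  show ?case
  proof (cases p)
    case Nil
    then have "s \<in> fst ` set (rounds F A [(t, [])])" using Cons.IH[of s "[]"] Cons.prems by simp
    then show ?thesis using pass_keys[of "rounds F A [(t, [])]" A] by auto
  next
    case (Cons x q)
    then have "ahead x \<in> fst ` set (rounds F A [(t, [])])"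
      using Cons.IH[of "ahead x" q] Cons.prems by simp
    then show ?thesis using pass_reaches[of x A] Cons Cons.prems by auto
  qed
qed simp

lemma search_paths: "paths_to (set A) t (rounds A A [(t, [])])"
  by (rule rounds_paths) (simp add: paths_to_def)

lemma search_sound:
  assumes "search A s t = Some e"
  shows "walk (set A) s (snd e) t" "distinct (map fst (snd e) @ [t])"
proof -
  have "(s, snd e) \<in> set (rounds A A [(t, [])])"
    using lookup_Some[OF assms[unfolded search_def]] by (metis prod.collapse)
  then have "walk (set A) s (snd e) t \<and> distinct (map fst (snd e) @ [t])"
    using search_paths[of A t] unfolding paths_to_def by blast
  then show "walk (set A) s (snd e) t" "distinct (map fst (snd e) @ [t])" by auto
qed

lemma search_length:
  assumes "search A s t = Some e"
  shows "length (snd e) \<le> length A * length A"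
proof -
  have "(s, snd e) \<in> set (rounds A A [(t, [])])"
    using lookup_Some[OF assms[unfolded search_def]] by (metis prod.collapse)
  then have "length (snd e) < length (rounds A A [(t, [])])"
    using search_paths[of A t] unfolding paths_to_def by blast
  then show ?thesis using rounds_length[of A A "[(t, [])]"] by simp
qed

text \<open>A walk without repeated arcs has at most \<open>length A\<close> arcs, and each round
  settles one more arc of it; \<open>search\<close> runs \<open>length A\<close> rounds.\<close>

lemma search_complete:
  assumes "walk (set A) s p t" "distinct p"
  shows "search A s t \<noteq> None"
proof -
  have "card (set p) \<le> card (set A)" using walk_arcs[OF assms(1)] by (intro card_mono) auto
  then have "length p \<le> length A"
    using distinct_card[OF assms(2)] card_length[of A] by simp
  then show ?thesis
    using rounds_reaches[OF assms(1)] by (simp add: search_def lookup_None)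
qed

definition restrict_arcs :: "larc \<Rightarrow> larc \<Rightarrow> larc list \<Rightarrow> larc list" where
  "restrict_arcs b c A = filter (\<lambda>x. ahead x \<noteq> ahead b \<or> alabel x = alabel c) A"

text \<open>Deletion goes by label because both directions of an edge in the list made by
  \<open>avoid\<close> carry the same label. Both must disappear, or the path back could reuse the
  edge \<open>a\<close>.\<close>

definition del_label :: "larc \<Rightarrow> larc list \<Rightarrow> larc list" where
  "del_label a X = filter (\<lambda>x. alabel x \<noteq> alabel a) X"

text \<open>
  Every arc without a vertex on the dicycle \<open>B\<close> is kept in both directions. It is enough to
  compare with the tails in \<open>B\<close>.
\<close>

primrec avoid :: "larc list \<Rightarrow> larc list \<Rightarrow> larc list" where
  "avoid B [] = []"
| "avoid B (x # A) =
     (if lookup (atail x) B = None \<and> lookup (ahead x) B = None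
      then x # (ahead x, atail x, alabel x) # avoid B A else avoid B A)"

text \<open>The empty list stands for failure in the next two functions.\<close>

primrec ucycle :: "larc list \<Rightarrow> larc list \<Rightarrow> larc list" where
  "ucycle X [] = []"
| "ucycle X (a # Y) = (case search (del_label a X) (ahead a) (atail a) of
     None \<Rightarrow> ucycle X Y | Some e \<Rightarrow> a # snd e)"

definition dicycle_through :: "larc list \<Rightarrow> larc \<Rightarrow> larc \<Rightarrow> larc \<Rightarrow> larc list" where
  "dicycle_through A a b c = (case search (restrict_arcs b c A) (ahead a) (atail a) of
     None \<Rightarrow> [] | Some e \<Rightarrow> a # snd e)"

definition answer_pair :: "larc list \<Rightarrow> larc list \<Rightarrow> (nat list \<times> nat list) option" where
  "answer_pair B C = (if C = [] then None else Some (map alabel B, map alabel C))"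

definition complete_dicycle :: "larc list \<Rightarrow> larc list \<Rightarrow> (nat list \<times> nat list) option" where
  "complete_dicycle A B =
     (if B = [] then None else answer_pair B (ucycle (avoid B A) (avoid B A)))"

primrec try_c :: "larc list \<Rightarrow> larc \<Rightarrow> larc \<Rightarrow> larc list \<Rightarrow> (nat list \<times> nat list) option" where
  "try_c A a b [] = None"
| "try_c A a b (c # L) = (case complete_dicycle A (dicycle_through A a b c) of
     None \<Rightarrow> try_c A a b L | Some y \<Rightarrow> Some y)"

primrec try_b :: "larc list \<Rightarrow> larc \<Rightarrow> larc list \<Rightarrow> (nat list \<times> nat list) option" where
  "try_b A a [] = None"
| "try_b A a (b # L) = (case try_c A a b A of None \<Rightarrow> try_b A a L | Some y \<Rightarrow> Some y)"

primrec try_a :: "larc list \<Rightarrow> larc list \<Rightarrow> (nat list \<times> nat list) option" where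
  "try_a A [] = None"
| "try_a A (a # L) = (case try_b A a A of None \<Rightarrow> try_a A L | Some y \<Rightarrow> Some y)"

definition solve :: "digraph_input \<Rightarrow> (nat list \<times> nat list) option" where
  "solve I = (let A = number_arcs 0 (snd I) in try_a A A)"

section \<open>The loops over triples and the contents of the arc lists\<close>

lemma try_c_cases: "(case try_c A a b L of
    None \<Rightarrow> \<forall>c \<in> set L. complete_dicycle A (dicycle_through A a b c) = None
  | Some y \<Rightarrow> \<exists>c \<in> set L. complete_dicycle A (dicycle_through A a b c) = Some y)"
  by (induction L) (auto split: option.splits)

lemma try_b_cases: "(case try_b A a L of
    None \<Rightarrow> \<forall>b \<in> set L. try_c A a b A = None | Some y \<Rightarrow> \<exists>b \<in> set L. try_c A a b A = Some y)"
  by (induction L) (auto split: option.splits)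

lemma try_a_cases: "(case try_a A L of
    None \<Rightarrow> \<forall>a \<in> set L. try_b A a A = None | Some y \<Rightarrow> \<exists>a \<in> set L. try_b A a A = Some y)"
  by (induction L) (auto split: option.splits)

lemma try_a_None:
  assumes "try_a A A = None" "a \<in> set A" "b \<in> set A" "c \<in> set A"
  shows "complete_dicycle A (dicycle_through A a b c) = None"
proof -
  have "try_b A a A = None" using try_a_cases[of A A] assms(1,2) by simp
  then have "try_c A a b A = None" using try_b_cases[of A A a] assms(3) by simp
  then show ?thesis using try_c_cases[of A A a b] assms(4) by simp
qed

lemma try_a_Some:
  assumes "try_a A A = Some y"
  shows "\<exists>a \<in> set A. \<exists>b \<in> set A. \<exists>c \<in> set A. complete_dicycle A (dicycle_through A a b c) = Some y"
proof -
  obtain a where a: "a \<in> set A" "try_b A a A = Some y" using try_a_cases[of A A] assms by auto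
  obtain b where b: "b \<in> set A" "try_c A a b A = Some y" using try_b_cases[of A A a] a by auto
  obtain c where c: "c \<in> set A" "complete_dicycle A (dicycle_through A a b c) = Some y"
    using try_c_cases[of A A a b] b by auto
  show ?thesis using a b c by blast
qed

lemma ucycle_Nil:
  "ucycle X Y = [] \<Longrightarrow> a \<in> set Y \<Longrightarrow> search (del_label a X) (ahead a) (atail a) = None"
  by (induction Y) (auto split: option.splits)

lemma ucycle_Cons:
  "ucycle X Y \<noteq> [] \<Longrightarrow>
     \<exists>a e. a \<in> set Y \<and> search (del_label a X) (ahead a) (atail a) = Some e \<and> ucycle X Y = a # snd e"
  by (induction Y) (auto split: option.splits)

lemma set_avoid: "x \<in> set (avoid B A) \<longleftrightarrow>
    atail x \<notin> fst ` set B \<and> ahead x \<notin> fst ` set B \<and>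
    (x \<in> set A \<or> (ahead x, atail x, alabel x) \<in> set A)"
proof -
  define K where "K = fst ` set B"
  obtain u v l where "x = (u, v, l)" by (metis prod.collapse)
  then show ?thesis
    unfolding K_def[symmetric]
    by (induction A) (auto simp: lookup_None simp flip: K_def)
qed

lemma set_number_arcs:
  "x \<in> set (number_arcs k as) \<longleftrightarrow> (\<exists>i<length as. x = (fst (as ! i), snd (as ! i), k + i))"
proof (induction as arbitrary: k)
  case (Cons a as)
  have "(\<exists>i<length (a # as). x = (fst ((a # as) ! i), snd ((a # as) ! i), k + i)) \<longleftrightarrow>
    x = (fst a, snd a, k) \<or> (\<exists>i<length as. x = (fst (as ! i), snd (as ! i), Suc k + i))"
    by (auto simp: less_Suc_eq_0_disj)
  then show ?case using Cons.IH[of "Suc k"] by auto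
qed simp

locale input_digraph =
  fixes I :: digraph_input
  assumes wf: "wf_input I"
begin

sublocale D: fin_digraph "digraph_of I"
  using fin_digraph_digraph_of[OF wf] .

abbreviation D where "D \<equiv> digraph_of I"
abbreviation A where "A \<equiv> number_arcs 0 (snd I)"

text \<open>Translates arcs of \<open>D\<close> into entries of the list \<open>A\<close>;
  \<open>alabel\<close> translates back.\<close>

definition item :: "nat \<Rightarrow> larc" where "item i = (tail D i, head D i, i)"

lemma item_simps [simp]: "atail (item i) = tail D i" "ahead (item i) = head D i" "alabel (item i) = i"
  by (simp_all add: item_def)

lemma in_A: "x \<in> set A \<longleftrightarrow> alabel x \<in> arcs D \<and> atail x = tail D (alabel x) \<and> ahead x = head D (alabel x)"
  unfolding set_number_arcs by (cases x) (auto simp: digraph_of_def)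

lemma item_A: "item i \<in> set A \<longleftrightarrow> i \<in> arcs D"
  by (simp add: in_A)

section \<open>Dicycles as closed walks in the arc list\<close>

lemma walk_cas:
  "walk (set A) s p t \<Longrightarrow> D.cas s (map alabel p) t \<and> set (map alabel p) \<subseteq> arcs D \<and>
     map (tail D) (map alabel p) = map atail p"
  by (induction p arbitrary: s) (auto simp: in_A)

lemma cas_walk:
  "D.cas s q t \<Longrightarrow> set q \<subseteq> arcs D \<Longrightarrow> walk (set A) s (map item q) t"
  by (induction q arbitrary: s) (auto simp: item_A)

text \<open>The search guarantees distinct tails with the target appended. These are the vertices of
  the closed walk after the first one, just those that \<open>cycle\<close> requires to be
  distinct.\<close>

lemma dicycle_sound:
  assumes "a \<in> set A" "walk (set A) (ahead a) p (atail a)" "distinct (map atail p @ [atail a])"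
  shows "D.cycle (map alabel (a # p))"
proof -
  have w: "walk (set A) (atail a) (a # p) (atail a)" using assms by simp
  note c = walk_cas[OF w] walk_cas[OF assms(2)]
  have ne: "map alabel (a # p) \<noteq> []" by simp
  have "atail a \<in> verts D" using assms(1) by (simp add: in_A D.tail_in_verts)
  then have "D.awalk (atail a) (map alabel (a # p)) (atail a)"
    using c by (simp only: D.awalk_def)
  moreover have "head D (last (map alabel (a # p))) = atail a"
    using cas_last[OF c(1)[THEN conjunct1] ne] .
  then have "tl (D.awalk_verts (atail a) (map alabel (a # p))) = map atail p @ [atail a]"
    using c(2) by (simp add: D.awalk_verts_conv del: D.awalk_verts.simps)
  ultimately show ?thesis
    unfolding D.cycle_def using assms(3) ne by metis
qed

text \<open>The dicycle is cut open at \<open>e\<close>: the arcs after \<open>e\<close> are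
  followed by those before it.\<close>

lemma cycle_walk:
  assumes "D.cycle B" "e \<in> set B"
  shows "\<exists>p. walk (set A) (head D e) p (tail D e) \<and> distinct p \<and> set p \<subseteq> item ` set B"
proof -
  obtain u where u: "D.awalk u B u" using D.cycle_heads(5)[OF assms(1)] by blast
  have dB: "distinct B" "set B \<subseteq> arcs D" using D.cycle_heads(1,4)[OF assms(1)] by (auto simp: distinct_map)
  obtain xs ys where B: "B = xs @ e # ys" using assms(2) by (meson split_list)
  have c: "D.cas u xs (tail D e)" "D.cas (head D e) ys u" using u B by (auto simp: D.awalk_def)
  have w: "walk (set A) (head D e) (map item ys @ map item xs) (tail D e)"
    unfolding walk_append using cas_walk[OF c(1)] cas_walk[OF c(2)] dB(2) B by auto
  have "inj item" by (auto simp: inj_def item_def)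
  moreover have "distinct (ys @ xs)" using dB(1) B by auto
  ultimately have "distinct (map item (ys @ xs))"
    unfolding distinct_map by (blast intro: inj_on_subset)
  then show ?thesis using B w by (intro exI[of _ "map item (ys @ xs)"]) auto
qed

lemma arcs_verts_cycle:
  assumes "D.cycle (map alabel B)" "set B \<subseteq> set A"
  shows "arcs_verts D (map alabel B) = atail ` set B"
proof -
  have "head D ` alabel ` set B = tail D ` alabel ` set B"
    using D.cycle_heads(2)[OF assms(1)] by simp
  then have "arcs_verts D (map alabel B) = tail D ` alabel ` set B"
    unfolding arcs_verts_def ug_ends_def by auto
  also have "\<dots> = atail ` set B"
    unfolding image_image using assms(2) in_A by (intro image_cong) auto
  finally show ?thesis .
qed

section \<open>Cycles of the underlying multigraph\<close>

lemma ug_ends_item: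
  assumes "x \<in> set (avoid B A)"
  shows "alabel x \<in> arcs D" "ug_ends D (alabel x) = {atail x, ahead x}"
    "atail x \<notin> atail ` set B" "ahead x \<notin> atail ` set B"
  using assms unfolding set_avoid in_A by (simp_all only: ug_ends_def fst_conv snd_conv) auto

text \<open>Equal labels may belong to an arc and its reverse, so distinct arcs are not enough. If a
  later arc had the label of \<open>x\<close>, the tail of \<open>x\<close> would be one of its
  ends; but all later tails and heads are later tails or \<open>t\<close>, and these differ from the
  tail of \<open>x\<close>.\<close>

lemma distinct_labels:
  assumes "walk X s p t" "distinct (map atail p @ [t])"
    and "\<And>x y. x \<in> X \<Longrightarrow> y \<in> X \<Longrightarrow> alabel x = alabel y \<Longrightarrow> {atail x, ahead x} = {atail y, ahead y}"
  shows "distinct (map alabel p)"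
  using assms(1,2)
proof (induction p arbitrary: s)
  case (Cons x p)
  have heads: "ahead y \<in> insert t (atail ` set q)" if "walk X u q t" "y \<in> set q" for y q u
    using that
  proof (induction q arbitrary: u)
    case (Cons z q)
    then show ?case by (cases q) auto
  qed simp
  have "alabel y \<noteq> alabel x" if y: "y \<in> set p" for y
  proof
    assume l: "alabel y = alabel x"
    have w: "walk X (ahead x) p t" "x \<in> X" using Cons.prems(1) by auto
    have "y \<in> X" using y walk_arcs[OF w(1)] by blast
    then have "atail x \<in> {atail y, ahead y}" using assms(3)[OF w(2) _ l[symmetric]] by blast
    moreover have "ahead y \<in> insert t (atail ` set p)" using heads[OF w(1) y] .
    moreover have "atail y \<in> atail ` set p" using y by simp
    moreover have "atail x \<notin> insert t (atail ` set p)" using Cons.prems(2) by simp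
    ultimately show False by (metis doubleton_eq_iff empty_iff insert_iff)
  qed
  then have "alabel x \<notin> set (map alabel p)" by (metis (no_types, lifting) imageE list.set_map)
  moreover have "distinct (map alabel p)"
    using Cons.IH[of "ahead x"] Cons.prems by simp
  ultimately show ?case by simp
qed simp

lemma walk_ends:
  "walk X s p t \<Longrightarrow> i < length p \<Longrightarrow> ahead (p ! i) = (map atail p @ [t]) ! Suc i"
proof (induction p arbitrary: s i)
  case (Cons x p)
  show ?case
  proof (cases i)
    case 0 then show ?thesis using Cons.prems by (cases p) auto
  next
    case (Suc j) then show ?thesis using Cons.IH[of "ahead x" j] Cons.prems by simp
  qed
qed simp

text \<open>The path back from the head of \<open>a\<close> to its tail closes a cycle because it
  cannot use the edge \<open>a\<close> itself. If \<open>a\<close> is a loop, the path is empty and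
  the cycle has length one; an arc parallel or opposite to \<open>a\<close> gives length
  two.\<close>

lemma ug_cycle_sound:
  assumes a: "a \<in> set (avoid B A)"
    and w: "walk (set (del_label a (avoid B A))) (ahead a) p (atail a)"
    and d: "distinct (map atail p @ [atail a])"
  shows "ug_cycle D (map alabel (a # p))"
    "arcs_verts D (map alabel (a # p)) \<inter> atail ` set B = {}"
proof -
  let ?X = "set (avoid B A)"
  have del: "set (del_label a (avoid B A)) = {x \<in> ?X. alabel x \<noteq> alabel a}"
    by (auto simp: del_label_def)
  have p: "x \<in> ?X" "alabel x \<noteq> alabel a" if "x \<in> set p" for x
    using walk_arcs[OF w] that unfolding del by blast+
  then have ap: "x \<in> ?X" if "x \<in> set (a # p)" for x
    using a that by (metis set_ConsD)
  show "arcs_verts D (map alabel (a # p)) \<inter> atail ` set B = {}"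
  proof (intro equals0I)
    fix v assume v: "v \<in> arcs_verts D (map alabel (a # p)) \<inter> atail ` set B"
    then obtain i where "i \<in> set (map alabel (a # p))" "v \<in> ug_ends D i"
      unfolding arcs_verts_def by blast
    then obtain x where x: "x \<in> set (a # p)" "v \<in> ug_ends D (alabel x)"
      unfolding set_map by blast
    then have "v = atail x \<or> v = ahead x" using ug_ends_item(2)[OF ap[OF x(1)]] by simp
    then show False using ug_ends_item(3,4)[OF ap[OF x(1)]] v by blast
  qed
  have same: "{atail x, ahead x} = {atail y, ahead y}" if "x \<in> ?X" "y \<in> ?X" "alabel x = alabel y" for x y
    using ug_ends_item(2)[of _ B] that by metis
  have wX: "walk ?X (ahead a) p (atail a)" using walk_mono[OF w] p by blast
  have dl: "distinct (map alabel (a # p))"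
  proof -
    have "distinct (map alabel p)" by (rule distinct_labels[OF wX d]) (rule same)
    moreover have "alabel a \<notin> set (map alabel p)"
    proof
      assume "alabel a \<in> set (map alabel p)"
      then obtain x where "alabel a = alabel x" "x \<in> set p" unfolding set_map by (rule imageE)
      then show False using p(2)[of x] by simp
    qed
    ultimately show ?thesis by simp
  qed
  let ?vs = "map atail (a # p)"
  have w': "walk ?X (atail a) (a # p) (atail a)" using wX a by simp
  show "ug_cycle D (map alabel (a # p))"
    unfolding ug_cycle_def
  proof (intro conjI exI[of _ ?vs] allI impI)
    show "set (map alabel (a # p)) \<subseteq> arcs D"
      unfolding set_map by (rule image_subsetI) (rule ug_ends_item(1)[OF ap])
    show "distinct ?vs" using d by auto
    show "set ?vs \<subseteq> verts D"
    proof
      fix v assume "v \<in> set ?vs"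
      then obtain x where x: "v = atail x" "x \<in> set (a # p)" unfolding set_map by (rule imageE)
      then have "v \<in> ug_ends D (alabel x)" "alabel x \<in> arcs D"
        using ug_ends_item(1,2)[OF ap[OF x(2)]] x(1) by simp_all
      then show "v \<in> verts D" by (auto simp: ug_ends_def D.tail_in_verts D.head_in_verts)
    qed
    fix i assume i: "i < length (map alabel (a # p))"
    then have i': "i < length (a # p)" by simp
    have "ug_ends D (alabel ((a # p) ! i)) = {atail ((a # p) ! i), ahead ((a # p) ! i)}"
      using ug_ends_item(2)[OF ap[OF nth_mem[OF i']]] .
    \<comment> \<open>At the last index the successor wraps around to index 0, whose vertex
      \<open>atail a\<close> is the end of the walk.\<close>
    moreover have "ahead ((a # p) ! i) = ?vs ! (Suc i mod length (map alabel (a # p)))"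
    proof (cases "Suc i < length (a # p)")
      case True
      then show ?thesis using walk_ends[OF w' i'] by (simp add: nth_append)
    next
      case False
      then have "Suc i = length (a # p)" using i' by simp
      then show ?thesis using walk_ends[OF w' i'] by (simp add: nth_append)
    qed
    ultimately show "ug_ends D (map alabel (a # p) ! i)
      = {?vs ! i, ?vs ! (Suc i mod length (map alabel (a # p)))}"
      using i' by (simp only: nth_map)
  qed (use dl in simp_all)
qed

lemma ug_cycle_complete:
  assumes C: "ug_cycle D C" and disj: "arcs_verts D C \<inter> atail ` set B = {}"
  shows "ucycle (avoid B A) (avoid B A) \<noteq> []"
proof
  assume nil: "ucycle (avoid B A) (avoid B A) = []"
  let ?n = "length C"
  from C obtain vs where C': "C \<noteq> []" "set C \<subseteq> arcs D" "distinct C" "length vs = ?n"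
    "\<And>i. i < ?n \<Longrightarrow> ug_ends D (C ! i) = {vs ! i, vs ! (Suc i mod ?n)}"
    unfolding ug_cycle_def by blast
  \<comment> \<open>The edges of \<open>C\<close>, oriented along the cycle. Whatever their
    directions in \<open>D\<close>, \<open>avoid\<close> offers both.\<close>
  define x where "x i = (vs ! i, vs ! (Suc i mod ?n), C ! i)" for i
  define K where "K = atail ` set B"
  have x_in: "x i \<in> set (avoid B A)" if "i < ?n" for i
  proof -
    have e: "ug_ends D (C ! i) = {vs ! i, vs ! (Suc i mod ?n)}" using C'(5) that .
    have "C ! i \<in> set C" using that by simp
    then have "ug_ends D (C ! i) \<inter> K = {}" "C ! i \<in> arcs D"
      using disj C'(2) unfolding arcs_verts_def K_def by blast+
    then show ?thesis
      unfolding set_avoid in_A x_def K_def[symmetric] using e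
      unfolding ug_ends_def doubleton_eq_iff by auto
  qed
  have "0 < ?n" using C'(1) by simp
  \<comment> \<open>\<open>x 0\<close> plays the part of the deleted arc, and
    \<open>x 1, ..., x m\<close> continue from its head. The index \<open>1 mod ?n\<close> below
    also covers a loop, where the walk is empty and starts at \<open>vs ! 0\<close>.\<close>
  define q where "q m = map x [1..<Suc m]" for m
  have walk_q: "m < ?n \<Longrightarrow> walk (set (q m)) (vs ! (1 mod ?n)) (q m) (vs ! (Suc m mod ?n))" for m
  proof (induction m)
    case 0 then show ?case by (simp add: q_def)
  next
    case (Suc m)
    have qS: "q (Suc m) = q m @ [x (Suc m)]" by (simp add: q_def)
    have "walk (set (q (Suc m))) (vs ! (1 mod ?n)) (q m) (vs ! (Suc m mod ?n))"
      using walk_mono[OF Suc.IH, of "set (q (Suc m))"] Suc.prems unfolding qS by auto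
    moreover have "walk (set (q (Suc m))) (vs ! (Suc m mod ?n)) [x (Suc m)] (vs ! (Suc (Suc m) mod ?n))"
      using Suc.prems unfolding qS by (simp add: x_def)
    ultimately show ?case unfolding qS walk_append by blast
  qed
  let ?p = "q (?n - 1)"
  have "set ?p \<subseteq> set (del_label (x 0) (avoid B A))"
  proof
    fix y assume "y \<in> set ?p"
    then obtain i where i: "1 \<le> i" "i < ?n" "y = x i" by (auto simp: q_def)
    then have "C ! i \<noteq> C ! 0" using nth_eq_iff_index_eq[OF C'(3), of i 0] \<open>0 < ?n\<close> by auto
    then show "y \<in> set (del_label (x 0) (avoid B A))"
      using x_in[OF i(2)] i(3) by (simp add: del_label_def x_def)
  qed
  moreover have "walk (set ?p) (vs ! (1 mod ?n)) ?p (vs ! 0)"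
    using walk_q[of "?n - 1"] \<open>0 < ?n\<close> by simp
  ultimately have "walk (set (del_label (x 0) (avoid B A))) (ahead (x 0)) ?p (atail (x 0))"
    using walk_mono by (auto simp: x_def)
  moreover have "distinct (map alabel ?p)"
  proof -
    have "map alabel ?p = map (\<lambda>i. C ! i) [1..<?n]" using \<open>0 < ?n\<close> by (simp add: q_def x_def)
    then show ?thesis using C'(3) by (auto simp: distinct_map inj_on_def nth_eq_iff_index_eq)
  qed
  then have "distinct ?p" by (simp add: distinct_map)
  ultimately have "search (del_label (x 0) (avoid B A)) (ahead (x 0)) (atail (x 0)) \<noteq> None"
    by (rule search_complete)
  then show False using ucycle_Nil[OF nil x_in[OF \<open>0 < ?n\<close>]] by simp
qed

lemma dicycle_through_cases:
  assumes "a \<in> set A" "dicycle_through A a b c \<noteq> []"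
  obtains p where "dicycle_through A a b c = a # p" "D.cycle (map alabel (a # p))"
    "set p \<subseteq> set A" "\<forall>x \<in> set p. ahead x \<noteq> ahead b \<or> alabel x = alabel c"
proof -
  obtain e where e: "search (restrict_arcs b c A) (ahead a) (atail a) = Some e"
    "dicycle_through A a b c = a # snd e"
    using assms(2) by (auto simp: dicycle_through_def split: option.splits)
  note s = search_sound[OF e(1)]
  have sub: "set (snd e) \<subseteq> set (restrict_arcs b c A)" using walk_arcs[OF s(1)] .
  then have "set (snd e) \<subseteq> set A" by (auto simp: restrict_arcs_def)
  moreover have "D.cycle (map alabel (a # snd e))"
    using dicycle_sound[OF assms(1) walk_mono[OF s(1)] s(2)] calculation .
  ultimately show ?thesis using that[of "snd e"] e(2) sub by (auto simp: restrict_arcs_def)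
qed

lemma complete_dicycle_Some:
  assumes "a \<in> set A" "complete_dicycle A (dicycle_through A a b c) = Some (B, C)"
  shows "disjoint_dicycle_cycle D B C"
proof -
  let ?B = "dicycle_through A a b c"
  have ne: "?B \<noteq> []" and uc: "ucycle (avoid ?B A) (avoid ?B A) \<noteq> []"
    and BC: "B = map alabel ?B" "C = map alabel (ucycle (avoid ?B A) (avoid ?B A))"
    using assms(2) by (auto simp: complete_dicycle_def answer_pair_def split: if_splits)
  obtain p where p: "?B = a # p" "D.cycle (map alabel (a # p))" "set p \<subseteq> set A"
    using dicycle_through_cases[OF assms(1) ne] by blast
  have "arcs_verts D B = atail ` set ?B"
    using arcs_verts_cycle[of ?B] p assms(1) BC by simp
  moreover obtain x e where x: "x \<in> set (avoid ?B A)"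
    "search (del_label x (avoid ?B A)) (ahead x) (atail x) = Some e"
    "ucycle (avoid ?B A) (avoid ?B A) = x # snd e"
    using ucycle_Cons[OF uc] by blast
  ultimately show ?thesis
    using ug_cycle_sound[OF x(1) search_sound[OF x(2)]] p BC
    unfolding disjoint_dicycle_cycle_def by (simp add: Int_commute)
qed

text \<open>\<open>B\<close> cut open at \<open>e\<close> is a walk in the restricted list, so the
  search succeeds, though perhaps with another dicycle. By \<open>min\<close> that one uses only
  arcs of \<open>B\<close>, so \<open>C\<close> avoids it too and is there to be found.\<close>

lemma complete_dicycle_None:
  assumes "disjoint_dicycle_cycle D B C" "e \<in> set B" "b \<in> arcs D" "c \<in> arcs D"
    and F: "\<forall>x \<in> set B. head D x \<noteq> head D b \<or> x = c"
    and min: "\<And>B'. D.cycle B' \<Longrightarrow> e \<in> set B' \<Longrightarrow> \<forall>x \<in> set B'. head D x \<noteq> head D b \<or> x = c \<Longrightarrow>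
      set B' \<subseteq> set B"
  shows "complete_dicycle A (dicycle_through A (item e) (item b) (item c)) \<noteq> None"
proof -
  let ?B = "dicycle_through A (item e) (item b) (item c)"
  have BC: "D.cycle B" "ug_cycle D C" "arcs_verts D B \<inter> arcs_verts D C = {}"
    using assms(1) by (auto simp: disjoint_dicycle_cycle_def)
  have e_in: "item e \<in> set A" using D.cycle_heads(4)[OF BC(1)] assms(2) item_A by blast
  obtain p where p: "walk (set A) (head D e) p (tail D e)" "distinct p" "set p \<subseteq> item ` set B"
    using cycle_walk[OF BC(1) assms(2)] by blast
  have "set p \<subseteq> set (restrict_arcs (item b) (item c) A)"
    using p(3) walk_arcs[OF p(1)] F by (auto simp: restrict_arcs_def)
  then have "search (restrict_arcs (item b) (item c) A) (head D e) (tail D e) \<noteq> None"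
    using search_complete[OF walk_mono[OF p(1)] p(2)] by blast
  then have ne: "?B \<noteq> []" by (auto simp: dicycle_through_def)
  obtain q where q: "?B = item e # q" "D.cycle (map alabel (item e # q))" "set q \<subseteq> set A"
    "\<forall>x \<in> set q. ahead x \<noteq> ahead (item b) \<or> alabel x = alabel (item c)"
    using dicycle_through_cases[OF e_in ne] by blast
  have "set (map alabel ?B) \<subseteq> set B"
  proof (rule min)
    show "D.cycle (map alabel ?B)" using q by simp
    show "e \<in> set (map alabel ?B)" using q(1) by simp
    have "head D (alabel x) \<noteq> head D b \<or> alabel x = c" if "x \<in> set q" for x
    proof -
      have "ahead x = head D (alabel x)" using q(3) that in_A by blast
      then show ?thesis using q(4) that by auto
    qed
    \<comment> \<open>The arc \<open>item e\<close> does not come from the restricted list; it meets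
      the condition because \<open>e\<close> lies on \<open>B\<close>.\<close>
    then show "\<forall>x\<in>set (map alabel ?B). head D x \<noteq> head D b \<or> x = c"
      using q(1) F assms(2) by auto
  qed
  then have "arcs_verts D (map alabel ?B) \<subseteq> arcs_verts D B" unfolding arcs_verts_def by blast
  moreover have "arcs_verts D (map alabel ?B) = atail ` set ?B"
    using arcs_verts_cycle[of ?B] q e_in by simp
  ultimately have "arcs_verts D C \<inter> atail ` set ?B = {}" using BC(3) by blast
  then have "ucycle (avoid ?B A) (avoid ?B A) \<noteq> []" by (rule ug_cycle_complete[OF BC(2)])
  then show ?thesis using ne by (simp add: complete_dicycle_def answer_pair_def)
qed

theorem solve_correct:
  assumes "unique_nontrivial_scc_subdivided_multiwheel D"
  shows "correct_answer D (solve I)"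
proof (cases "solve I")
  case (Some y)
  obtain B C where y: "y = (B, C)" by (cases y)
  obtain a b c where "a \<in> set A" "complete_dicycle A (dicycle_through A a b c) = Some (B, C)"
    using try_a_Some[of A] Some y by (auto simp: solve_def Let_def)
  then show ?thesis using complete_dicycle_Some Some y by (simp add: correct_answer_def)
next
  case None
  have "False" if BC: "disjoint_dicycle_cycle D B C" for B C
  proof -
    have cB: "D.cycle B" using BC by (simp add: disjoint_dicycle_cycle_def)
    obtain e b c where e: "e \<in> set B" "b \<in> arcs D" "c \<in> arcs D"
      "\<forall>x \<in> set B. head D x \<noteq> head D b \<or> x = c"
      "\<forall>B'. D.cycle B' \<longrightarrow> e \<in> set B' \<longrightarrow> (\<forall>x \<in> set B'. head D x \<noteq> head D b \<or> x = c) \<longrightarrow> set B' \<subseteq> set B"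
      using D.dicycle_singled_out[OF assms cB] by blast
    have "e \<in> arcs D" using D.cycle_heads(4)[OF cB] e(1) by blast
    then have "complete_dicycle A (dicycle_through A (item e) (item b) (item c)) = None"
      using try_a_None[of A] None e item_A by (simp add: solve_def Let_def)
    then show False using complete_dicycle_None[OF BC e(1-4)] e(5) by blast
  qed
  then show ?thesis using None by (auto simp: correct_answer_def)
qed

end

section \<open>Program verification\<close>

definition terminates :: "program \<Rightarrow> nat \<Rightarrow> sexp list \<Rightarrow> bool" where
  "terminates P f xs \<longleftrightarrow> f < length P \<and> (\<exists>y t. eval P xs (P ! f) y t)"

text \<open>Evaluation is deterministic, so value and time are functions of the arguments. This lets
  a call be described by terms instead of existential quantifiers.\<close>

definition result :: "program \<Rightarrow> nat \<Rightarrow> sexp list \<Rightarrow> sexp" where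
  "result P f xs = (THE y. \<exists>t. eval P xs (P ! f) y t)"

definition time :: "program \<Rightarrow> nat \<Rightarrow> sexp list \<Rightarrow> nat" where
  "time P f xs = (THE t. \<exists>y. eval P xs (P ! f) y t)"

definition computes :: "program \<Rightarrow> nat \<Rightarrow> sexp list \<Rightarrow> sexp \<Rightarrow> nat \<Rightarrow> bool" where
  "computes P f xs y T \<longleftrightarrow> terminates P f xs \<and> result P f xs = y \<and> time P f xs \<le> T"

lemma result_time_eqI:
  assumes "eval P xs (P ! f) y t"
  shows "result P f xs = y" "time P f xs = t"
  unfolding result_def time_def
  using assms eval_deterministic(1)[OF assms] by (blast intro: the_equality)+

lemma eval_result_time: "terminates P f xs \<Longrightarrow> eval P xs (P ! f) (result P f xs) (time P f xs)"
  unfolding terminates_def using result_time_eqI by metis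

text \<open>Weakest precondition for total correctness; the postcondition also sees the number of
  steps. With the equations below, simplification evaluates a function body symbolically.\<close>

definition wp :: "program \<Rightarrow> sexp list \<Rightarrow> expr \<Rightarrow> (sexp \<Rightarrow> nat \<Rightarrow> bool) \<Rightarrow> bool" where
  "wp P env e Q \<longleftrightarrow> (\<exists>y t. eval P env e y t \<and> Q y t)"

definition wps :: "program \<Rightarrow> sexp list \<Rightarrow> expr list \<Rightarrow> (sexp list \<Rightarrow> nat \<Rightarrow> bool) \<Rightarrow> bool" where
  "wps P env es Q \<longleftrightarrow> (\<exists>ys t. evals P env es ys t \<and> Q ys t)"

lemmas eval_Suc_intros = eval_evals.intros[simplified]

lemma wp_Var [simp]: "i < length env \<Longrightarrow> wp P env (Var i) Q \<longleftrightarrow> Q (env ! i) 1"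
  unfolding wp_def by (auto elim: eval_VarE intro: eval_Var[unfolded One_nat_def])

lemma wp_Empty [simp]: "wp P env Empty Q \<longleftrightarrow> Q Leaf 1"
  unfolding wp_def by (auto elim: eval_EmptyE intro: eval_Empty[unfolded One_nat_def])

lemma wp_Cons_of [simp]:
  "wp P env (Cons_of e1 e2) Q \<longleftrightarrow>
     wp P env e1 (\<lambda>x t. wp P env e2 (\<lambda>y s. Q (Node x y) (t + s + 1)))"
  unfolding wp_def by (auto elim!: eval_ConsE) (blast intro: eval_Suc_intros)+

lemma wp_Left [simp]: "wp P env (Left e) Q \<longleftrightarrow> wp P env e (\<lambda>x t. Q (left x) (t + 1))"
  unfolding wp_def by (auto elim!: eval_LeftE) (blast intro: eval_Suc_intros)+

lemma wp_Right [simp]: "wp P env (Right e) Q \<longleftrightarrow> wp P env e (\<lambda>x t. Q (right x) (t + 1))"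
  unfolding wp_def by (auto elim!: eval_RightE) (blast intro: eval_Suc_intros)+

lemma wp_Cond [simp]:
  "wp P env (Cond e e1 e2) Q \<longleftrightarrow>
     wp P env e (\<lambda>x t. if x = Leaf then wp P env e2 (\<lambda>y s. Q y (t + s + 1))
                      else wp P env e1 (\<lambda>y s. Q y (t + s + 1)))" (is "?L \<longleftrightarrow> ?R")
proof
  show "?L \<Longrightarrow> ?R"
    unfolding wp_def by (auto elim!: eval_CondE)
next
  assume ?R
  then obtain x t where x: "eval P env e x t"
    and r: "if x = Leaf then wp P env e2 (\<lambda>y s. Q y (t + s + 1))
      else wp P env e1 (\<lambda>y s. Q y (t + s + 1))"
    unfolding wp_def by blast
  show ?L
  proof (cases x)
    case Leaf
    then show ?thesis using x r unfolding wp_def by auto (blast intro: eval_Suc_intros)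
  next
    case (Node y z)
    then show ?thesis using x r unfolding wp_def by auto (blast intro: eval_Suc_intros)
  qed
qed

lemma wps_Nil [simp]: "wps P env [] Q \<longleftrightarrow> Q [] 0"
  unfolding wps_def by (auto elim: evals_NilE intro: evals_Nil)

lemma wps_Cons [simp]:
  "wps P env (e # es) Q \<longleftrightarrow> wp P env e (\<lambda>x t. wps P env es (\<lambda>xs s. Q (x # xs) (t + s)))"
  unfolding wps_def wp_def by (safe elim!: evals_ConsE) (blast intro: evals_Cons)+

text \<open>A call is not unfolded, as this would not end for recursive functions. It leaves
  \<open>terminates\<close>, \<open>result\<close> and \<open>time\<close> of the callee, which are
  rewritten by earlier facts or by the induction hypothesis.\<close>

lemma wp_Call [simp]:
  "wp P env (Call f es) Q \<longleftrightarrow>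
     wps P env es (\<lambda>xs t. terminates P f xs \<and> Q (result P f xs) (t + time P f xs + 1))"
proof
  assume "wp P env (Call f es) Q"
  then obtain y t where y: "eval P env (Call f es) y t" "Q y t" unfolding wp_def by blast
  from y(1) obtain xs s s' where a: "t = s + s' + 1" "f < length P" "evals P env es xs s"
    "eval P xs (P ! f) y s'" by (auto elim: eval_CallE)
  then show "wps P env es (\<lambda>xs t. terminates P f xs \<and> Q (result P f xs) (t + time P f xs + 1))"
    using result_time_eqI[OF a(4)] y(2) unfolding wps_def terminates_def by blast
next
  assume "wps P env es (\<lambda>xs t. terminates P f xs \<and> Q (result P f xs) (t + time P f xs + 1))"
  then obtain xs t where "evals P env es xs t" "terminates P f xs"
    "Q (result P f xs) (t + time P f xs + 1)" unfolding wps_def by blast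
  then show "wp P env (Call f es) Q"
    unfolding wp_def using eval_result_time eval_Call unfolding terminates_def by blast
qed

lemma computesI:
  assumes "f < length P" "wp P xs (P ! f) (\<lambda>y' t. y' = y \<and> t \<le> T)"
  shows "computes P f xs y T"
proof -
  obtain t where "eval P xs (P ! f) y t" "t \<le> T" using assms(2) unfolding wp_def by blast
  then show ?thesis
    using assms(1) result_time_eqI unfolding computes_def terminates_def by metis
qed

lemma computesD:
  assumes "computes P f xs y T"
  shows "terminates P f xs" "result P f xs = y" "time P f xs \<le> T"
  using assms by (auto simp: computes_def)

lemma computes_mono: "computes P f xs y T \<Longrightarrow> T \<le> T' \<Longrightarrow> computes P f xs y T'"
  by (auto simp: computes_def)

lemma computes_run: "computes P 0 [x] y T \<Longrightarrow> \<exists>t. run P x y t \<and> t \<le> T"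
  unfolding computes_def run_def using eval_result_time terminates_def by fastforce

text \<open>The polynomial of the final bound is never written out; closure under sums, products and
  composition yields it.\<close>

definition polynomial_fun :: "(nat \<Rightarrow> nat) \<Rightarrow> bool" where
  "polynomial_fun T \<longleftrightarrow> (\<exists>q :: nat poly. \<forall>n. T n = poly q n)"

lemma polynomial_fun_const: "polynomial_fun (\<lambda>n. c)"
  unfolding polynomial_fun_def by (rule exI[of _ "[:c:]"]) simp

lemma polynomial_fun_id: "polynomial_fun (\<lambda>n. n)"
  unfolding polynomial_fun_def by (rule exI[of _ "[:0, 1:]"]) simp

lemma polynomial_fun_add: "polynomial_fun S \<Longrightarrow> polynomial_fun T \<Longrightarrow> polynomial_fun (\<lambda>n. S n + T n)"
  unfolding polynomial_fun_def by (metis poly_add)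

lemma polynomial_fun_mult: "polynomial_fun S \<Longrightarrow> polynomial_fun T \<Longrightarrow> polynomial_fun (\<lambda>n. S n * T n)"
  unfolding polynomial_fun_def by (metis poly_mult)

lemma polynomial_fun_comp: "polynomial_fun S \<Longrightarrow> polynomial_fun T \<Longrightarrow> polynomial_fun (\<lambda>n. S (T n))"
  unfolding polynomial_fun_def by (metis poly_pcompose)

lemmas polynomial_funI =
  polynomial_fun_const polynomial_fun_id polynomial_fun_add polynomial_fun_mult

section \<open>The program and its running time\<close>

text \<open>The numbers in calls are positions in the list \<open>prog\<close> below.\<close>

definition tail_of :: "expr \<Rightarrow> expr" where "tail_of e = Left e"
definition head_of :: "expr \<Rightarrow> expr" where "head_of e = Left (Right e)"
definition label_of :: "expr \<Rightarrow> expr" where "label_of e = Right (Right e)"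

definition "solve_body =
   Call 17 [Call 18 [Empty, Right (Var 0)], Call 18 [Empty, Right (Var 0)]]"

definition "eq_body =
   Cond (Var 0) (Cond (Var 1) (Call 1 [Right (Var 0), Right (Var 1)]) Empty)
     (Cond (Var 1) Empty (Cons_of Empty Empty))"

definition "lookup_body =
   Cond (Var 1) (Cond (Call 1 [Var 0, Left (Left (Var 1))]) (Left (Var 1))
     (Call 2 [Var 0, Right (Var 1)])) Empty"

text \<open>The language has no local binding, so a value that is tested and then used is computed
  twice, here the entry of the head. The same happens in many bodies below.\<close>

definition "extend_body =
   Cond (Call 2 [tail_of (Var 0), Var 1]) (Var 1)
     (Cond (Call 2 [head_of (Var 0), Var 1])
       (Cons_of (Cons_of (tail_of (Var 0))
         (Cons_of (Var 0) (Right (Call 2 [head_of (Var 0), Var 1])))) (Var 1))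
       (Var 1))"

definition "pass_body =
   Cond (Var 0) (Call 3 [Left (Var 0), Call 4 [Right (Var 0), Var 1]]) (Var 1)"

definition "rounds_body =
   Cond (Var 0) (Call 4 [Var 1, Call 5 [Right (Var 0), Var 1, Var 2]]) (Var 2)"

definition "search_body =
   Call 2 [Var 1, Call 5 [Var 0, Var 0, Cons_of (Cons_of (Var 2) Empty) Empty]]"

definition "restrict_arcs_body =
   Cond (Var 2)
     (Cond (Call 1 [head_of (Left (Var 2)), head_of (Var 0)])
       (Cond (Call 1 [label_of (Left (Var 2)), label_of (Var 1)])
         (Cons_of (Left (Var 2)) (Call 7 [Var 0, Var 1, Right (Var 2)]))
         (Call 7 [Var 0, Var 1, Right (Var 2)]))
       (Cons_of (Left (Var 2)) (Call 7 [Var 0, Var 1, Right (Var 2)])))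
     Empty"

definition "del_label_body =
   Cond (Var 1)
     (Cond (Call 1 [label_of (Left (Var 1)), label_of (Var 0)])
       (Call 8 [Var 0, Right (Var 1)])
       (Cons_of (Left (Var 1)) (Call 8 [Var 0, Right (Var 1)])))
     Empty"

definition "avoid_body =
   Cond (Var 1)
     (Cond (Call 2 [tail_of (Left (Var 1)), Var 0])
       (Call 9 [Var 0, Right (Var 1)])
       (Cond (Call 2 [head_of (Left (Var 1)), Var 0])
         (Call 9 [Var 0, Right (Var 1)])
         (Cons_of (Left (Var 1))
           (Cons_of (Cons_of (head_of (Left (Var 1)))
               (Cons_of (tail_of (Left (Var 1))) (label_of (Left (Var 1)))))
             (Call 9 [Var 0, Right (Var 1)])))))
     Empty"

definition "ucycle_body =
   Cond (Var 1)
     (Cond (Call 6 [Call 8 [Left (Var 1), Var 0], head_of (Left (Var 1)), tail_of (Left (Var 1))])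
       (Cons_of (Left (Var 1)) (Right (Call 6 [Call 8 [Left (Var 1), Var 0],
         head_of (Left (Var 1)), tail_of (Left (Var 1))])))
       (Call 10 [Var 0, Right (Var 1)]))
     Empty"

definition "dicycle_through_body =
   Cond (Call 6 [Call 7 [Var 2, Var 3, Var 0], head_of (Var 1), tail_of (Var 1)])
     (Cons_of (Var 1) (Right (Call 6 [Call 7 [Var 2, Var 3, Var 0], head_of (Var 1), tail_of (Var 1)])))
     Empty"

definition "labels_body =
   Cond (Var 0) (Cons_of (label_of (Left (Var 0))) (Call 12 [Right (Var 0)])) Empty"

definition "answer_pair_body =
   Cond (Var 1) (Cons_of (Call 12 [Var 0]) (Call 12 [Var 1])) Empty"

definition "complete_dicycle_body =
   Cond (Var 1)
     (Call 13 [Var 1, Call 10 [Call 9 [Var 1, Var 0], Call 9 [Var 1, Var 0]]]) Empty"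

definition "try_c_body =
   Cond (Var 3)
     (Cond (Call 14 [Var 0, Call 11 [Var 0, Var 1, Var 2, Left (Var 3)]])
       (Call 14 [Var 0, Call 11 [Var 0, Var 1, Var 2, Left (Var 3)]])
       (Call 15 [Var 0, Var 1, Var 2, Right (Var 3)]))
     Empty"

definition "try_b_body =
   Cond (Var 2)
     (Cond (Call 15 [Var 0, Var 1, Left (Var 2), Var 0])
       (Call 15 [Var 0, Var 1, Left (Var 2), Var 0])
       (Call 16 [Var 0, Var 1, Right (Var 2)]))
     Empty"

definition "try_a_body =
   Cond (Var 1)
     (Cond (Call 16 [Var 0, Left (Var 1), Var 0])
       (Call 16 [Var 0, Left (Var 1), Var 0])
       (Call 17 [Var 0, Right (Var 1)]))
     Empty"

definition "number_arcs_body =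
   Cond (Var 1)
     (Cons_of (Cons_of (Left (Left (Var 1))) (Cons_of (Right (Left (Var 1))) (Var 0)))
       (Call 18 [Cons_of Empty (Var 0), Right (Var 1)]))
     Empty"

definition prog :: program where
  "prog =
     [solve_body, eq_body, lookup_body, extend_body, pass_body, rounds_body, search_body,
      restrict_arcs_body, del_label_body, avoid_body, ucycle_body, dicycle_through_body,
      labels_body, answer_pair_body, complete_dicycle_body, try_c_body, try_b_body,
      try_a_body, number_arcs_body]"

lemma prog_nth [simp]:
  "prog ! 0 = solve_body"
  "prog ! (Suc 0) = eq_body"
  "prog ! 2 = lookup_body"
  "prog ! 3 = extend_body"
  "prog ! 4 = pass_body"
  "prog ! 5 = rounds_body"
  "prog ! 6 = search_body"
  "prog ! 7 = restrict_arcs_body"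
  "prog ! 8 = del_label_body"
  "prog ! 9 = avoid_body"
  "prog ! 10 = ucycle_body"
  "prog ! 11 = dicycle_through_body"
  "prog ! 12 = labels_body"
  "prog ! 13 = answer_pair_body"
  "prog ! 14 = complete_dicycle_body"
  "prog ! 15 = try_c_body"
  "prog ! 16 = try_b_body"
  "prog ! 17 = try_a_body"
  "prog ! 18 = number_arcs_body"
  by (simp_all add: prog_def)


lemma length_prog [simp]: "length prog = 19"
  by (simp add: prog_def)

lemma wp_accessors [simp]:
  "wp P env (tail_of e) Q \<longleftrightarrow> wp P env e (\<lambda>x t. Q (left x) (t + 1))"
  "wp P env (head_of e) Q \<longleftrightarrow> wp P env e (\<lambda>x t. Q (left (right x)) (t + 2))"
  "wp P env (label_of e) Q \<longleftrightarrow> wp P env e (\<lambda>x t. Q (right (right x)) (t + 2))"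
  by (simp_all add: tail_of_def head_of_def label_of_def)

section \<open>Encodings, and running times of the auxiliary functions\<close>

definition enc_bool :: "bool \<Rightarrow> sexp" where
  "enc_bool b = (if b then Node Leaf Leaf else Leaf)"

text \<open>Distinguishes success from failure only if \<open>enc\<close> never yields
  \<open>Leaf\<close>, as is the case for pairs.\<close>

definition enc_option :: "('a \<Rightarrow> sexp) \<Rightarrow> 'a option \<Rightarrow> sexp" where
  "enc_option enc y = (case y of None \<Rightarrow> Leaf | Some x \<Rightarrow> enc x)"

abbreviation enc_arc :: "larc \<Rightarrow> sexp" where
  "enc_arc \<equiv> enc_pair enc_nat (enc_pair enc_nat enc_nat)"

abbreviation enc_arcs :: "larc list \<Rightarrow> sexp" where
  "enc_arcs \<equiv> enc_list enc_arc"

abbreviation enc_entry :: "nat \<times> larc list \<Rightarrow> sexp" where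
  "enc_entry \<equiv> enc_pair enc_nat enc_arcs"

lemma enc_simps [simp]:
  "enc_bool b = Leaf \<longleftrightarrow> \<not> b"
  "enc_option enc None = Leaf" "enc_option enc (Some x) = enc x"
  "left (enc_pair enc1 enc2 z) = enc1 (fst z)" "right (enc_pair enc1 enc2 z) = enc2 (snd z)"
  "enc_pair enc1 enc2 z \<noteq> Leaf" "Leaf \<noteq> enc_pair enc1 enc2 z"
  "enc_list enc xs = Leaf \<longleftrightarrow> xs = []"
  by (simp_all add: enc_bool_def enc_option_def enc_pair_def split: prod.split)
    (cases xs, simp_all)

lemma enc_pair_Pair [simp]: "enc_pair enc1 enc2 (x, y) = Node (enc1 x) (enc2 y)"
  by (simp add: enc_pair_def)

text \<open>Both numbers are peeled in parallel, so the first alone bounds the time; 12 steps are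
  ample for one level.\<close>

lemma computes_eq:
  "computes prog (Suc 0) [enc_nat a, enc_nat b] (enc_bool (a = b)) (12 * (a + 1))"
proof (induction a arbitrary: b)
  case 0
  show ?case
    by (rule computesI; cases b) (simp_all add: eq_body_def enc_bool_def)
next
  case (Suc a)
  note IH = computesD[OF Suc.IH]
  show ?case
  proof (rule computesI; cases b)
    fix b' assume "b = Suc b'"
    then show "wp prog [enc_nat (Suc a), enc_nat b] (prog ! Suc 0)
      (\<lambda>y t. y = enc_bool (Suc a = b) \<and> t \<le> 12 * (Suc a + 1))"
      using IH(3)[of b'] by (simp add: eq_body_def IH(1,2))
  qed (simp_all add: eq_body_def enc_bool_def)
qed

text \<open>The factors 2 and 3 below count the calls of one function that a single evaluation of a
  body can make, and \<open>N + 1\<close> counts the calls in a recursion along a list. In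
  \<open>T_complete\<close> the summand \<open>40 * (N + 1)\<close> pays for extracting two label
  lists. The other additive constants are generous allowances for the steps of one body.\<close>

definition "T_eq (N :: nat) = 12 * (N + 1)"
definition "T_lookup (N :: nat) = (T_eq N + 40) * (N + 1)"
definition "T_extend (N :: nat) = 3 * T_lookup N + 60"
definition "T_pass (N :: nat) = (T_extend N + 40) * (N + 1)"
definition "T_rounds (N :: nat) = (T_pass N + 40) * (N + 1)"
definition "T_search (N :: nat) = T_rounds N + T_lookup N + 60"
definition "T_filter (N :: nat) = (2 * T_eq N + 60) * (N + 1)"
definition "T_avoid (N :: nat) = (2 * T_lookup N + 80) * (N + 1)"
definition "T_dicycle (N :: nat) = 2 * T_filter N + 2 * T_search N + 60"
definition "T_ucycle (N :: nat) = (2 * T_filter N + 2 * T_search N + 80) * (N + 1)"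
definition "T_complete (N :: nat) = T_ucycle N + 2 * T_avoid N + 40 * (N + 1) + 80"
definition "T_try_c (N :: nat) = (2 * T_complete N + 2 * T_dicycle N + 80) * (N + 1)"
definition "T_try_b (N :: nat) = (2 * T_try_c N + 80) * (N + 1)"
definition "T_try_a (N :: nat) = (2 * T_try_b N + 80) * (N + 1)"

text \<open>
  All bounds are in terms of a single number \<open>N\<close> that exceeds all vertices, labels and list
  lengths that occur. The states of a search in \<open>A\<close> have at most \<open>length A * length A + 1\<close>
  entries, hence \<open>small\<close>; \<open>fits\<close> provides for the doubled arc list of \<open>avoid\<close>.
\<close>

definition arc_le :: "nat \<Rightarrow> larc \<Rightarrow> bool" where
  "arc_le N x \<longleftrightarrow> atail x \<le> N \<and> ahead x \<le> N \<and> alabel x \<le> N"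

definition small :: "nat \<Rightarrow> larc list \<Rightarrow> bool" where
  "small N A \<longleftrightarrow> (\<forall>x \<in> set A. arc_le N x) \<and> length A * length A + length A + 1 \<le> N"

lemma small_length: "small N A \<Longrightarrow> length A \<le> N"
  by (simp add: small_def)

lemma small_filter:
  assumes "small N A"
  shows "small N (filter Q A)"
proof -
  have "length (filter Q A) * length (filter Q A) + length (filter Q A) \<le> length A * length A + length A"
    by (intro add_mono mult_le_mono length_filter_le)
  then show ?thesis using assms by (simp add: small_def)
qed

lemma times_Suc_le: "t \<le> C * (k + 1) \<Longrightarrow> k \<le> N \<Longrightarrow> t \<le> C * (N + 1)" for C :: nat
proof -
  assume t: "t \<le> C * (k + 1)" and "k \<le> N"
  then have "C * (k + 1) \<le> C * (N + 1)" by (intro mult_le_mono) simp_all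
  with t show ?thesis by (rule order_trans)
qed

lemma eq_time: "a \<le> N \<Longrightarrow> time prog (Suc 0) [enc_nat a, enc_nat b] \<le> T_eq N"
  using computesD(3)[OF computes_eq, of a b] by (simp add: T_eq_def)

lemmas eq_calc = computesD(1,2)[OF computes_eq]

lemma computes_lookup:
  assumes "u \<le> N"
  shows "computes prog 2 [enc_nat u, enc_list (enc_pair enc_nat enc) S]
    (enc_option (enc_pair enc_nat enc) (lookup u S)) ((T_eq N + 40) * (length S + 1))"
proof (induction S)
  case Nil
  show ?case by (rule computesI) (simp_all add: lookup_body_def)
next
  case (Cons e S)
  note IH = computesD[OF Cons.IH]
  show ?case
    by (rule computesI)
      (use IH(3) eq_time[OF assms, of "fst e"] in \<open>auto simp: lookup_body_def eq_calc IH(1,2)\<close>)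
qed

lemma lookup_calc:
  assumes "u \<le> N" "length S \<le> N"
  shows "terminates prog 2 [enc_nat u, enc_list (enc_pair enc_nat enc) S]"
    "result prog 2 [enc_nat u, enc_list (enc_pair enc_nat enc) S] =
      enc_option (enc_pair enc_nat enc) (lookup u S)"
    "time prog 2 [enc_nat u, enc_list (enc_pair enc_nat enc) S] \<le> T_lookup N"
proof -
  note l = computesD[OF computes_lookup[OF assms(1), of enc S]]
  show "terminates prog 2 [enc_nat u, enc_list (enc_pair enc_nat enc) S]"
    "result prog 2 [enc_nat u, enc_list (enc_pair enc_nat enc) S] =
      enc_option (enc_pair enc_nat enc) (lookup u S)"
    by (fact l)+
  show "time prog 2 [enc_nat u, enc_list (enc_pair enc_nat enc) S] \<le> T_lookup N"
    using times_Suc_le[OF l(3) assms(2)] by (simp add: T_lookup_def)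
qed

lemma computes_extend:
  assumes "arc_le N x" "length S \<le> N"
  shows "computes prog 3 [enc_arc x, enc_list enc_entry S] (enc_list enc_entry (extend x S)) (T_extend N)"
proof (rule computesI)
  have le: "atail x \<le> N" "ahead x \<le> N" using assms by (auto simp: arc_le_def)
  note t = lookup_calc[OF le(1) assms(2), of enc_arcs] and h = lookup_calc[OF le(2) assms(2), of enc_arcs]
  show "wp prog [enc_arc x, enc_list enc_entry S] (prog ! 3)
    (\<lambda>y' t. y' = enc_list enc_entry (extend x S) \<and> t \<le> T_extend N)"
    using t(3) h(3)
    by (cases "lookup (atail x) S"; cases "lookup (ahead x) S")
      (simp_all add: extend_body_def T_extend_def extend_def t(1,2) h(1,2))
qed simp

text \<open>Every arc adds at most one entry, so \<open>length B + length S\<close> bounds all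
  intermediate states, as the cost of \<open>extend\<close> requires.\<close>

lemma computes_pass:
  assumes "\<forall>x \<in> set B. arc_le N x" "length B + length S \<le> N"
  shows "computes prog 4 [enc_arcs B, enc_list enc_entry S] (enc_list enc_entry (pass B S))
    ((T_extend N + 40) * (length B + 1))"
  using assms
proof (induction B)
  case Nil
  show ?case by (rule computesI) (simp_all add: pass_body_def)
next
  case (Cons x B)
  then have IH: "computes prog 4 [enc_arcs B, enc_list enc_entry S] (enc_list enc_entry (pass B S))
    ((T_extend N + 40) * (length B + 1))" by simp
  have "computes prog 3 [enc_arc x, enc_list enc_entry (pass B S)]
    (enc_list enc_entry (extend x (pass B S))) (T_extend N)"
    using Cons.prems pass_length[of B S] by (intro computes_extend) auto
  note e = computesD[OF this] and IH = computesD[OF IH]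
  show ?case
    by (rule computesI) (use IH(3) e(3) in \<open>simp_all add: pass_body_def e(1,2) IH(1,2)\<close>)
qed

text \<open>The program only tests whether the counting list is empty, so its entries may be encoded
  arbitrarily. The assumed bound covers all intermediate states, by
  \<open>rounds_length\<close>.\<close>

lemma computes_rounds:
  assumes "\<forall>x \<in> set A. arc_le N x" "length F * length A + length S \<le> N"
  shows "computes prog 5 [enc_list enc F, enc_arcs A, enc_list enc_entry S]
    (enc_list enc_entry (rounds F A S)) ((T_pass N + 40) * (length F + 1))"
  using assms(2)
proof (induction F)
  case Nil
  show ?case by (rule computesI) (simp_all add: rounds_body_def)
next
  case (Cons y F)
  then have IH: "computes prog 5 [enc_list enc F, enc_arcs A, enc_list enc_entry S]
    (enc_list enc_entry (rounds F A S)) ((T_pass N + 40) * (length F + 1))" by simp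
  have "length A + length (rounds F A S) \<le> N"
    using Cons.prems rounds_length[of F A S] by simp
  from computesD[OF computes_pass[OF assms(1) this]]
  have p: "terminates prog 4 [enc_arcs A, enc_list enc_entry (rounds F A S)]"
    "result prog 4 [enc_arcs A, enc_list enc_entry (rounds F A S)] =
      enc_list enc_entry (pass A (rounds F A S))"
    "time prog 4 [enc_arcs A, enc_list enc_entry (rounds F A S)] \<le> T_pass N"
    using times_Suc_le[of _ "T_extend N + 40" "length A" N] \<open>length A + _ \<le> N\<close>
    by (auto simp: T_pass_def)
  note IH = computesD[OF IH]
  show ?case
    by (rule computesI) (use IH(3) p(3) in \<open>simp_all add: rounds_body_def p(1,2) IH(1,2)\<close>)
qed

lemma computes_search:
  assumes "small N A" "s \<le> N"
  shows "computes prog 6 [enc_arcs A, enc_nat s, enc_nat t] (enc_option enc_entry (search A s t)) (T_search N)"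
proof (rule computesI)
  \<comment> \<open>The search starts from a state with one entry; this accounts for the summand 1
    in \<open>small\<close>.\<close>
  have len: "length A * length A + length [(t, [] :: larc list)] \<le> N" and arcs: "\<forall>x \<in> set A. arc_le N x"
    using assms(1) by (auto simp: small_def)
  note r = computesD[OF computes_rounds[OF arcs len, where enc = enc_arc], simplified]
  have "time prog 5 [enc_arcs A, enc_arcs A, Node (Node (enc_nat t) Leaf) Leaf] \<le> T_rounds N"
    using times_Suc_le[of _ "T_pass N + 40" "length A" N] small_length[OF assms(1)] r(3)
    by (simp add: T_rounds_def)
  moreover have "length (rounds A A [(t, [])]) \<le> N" using rounds_length[of A A "[(t, [])]"] len by simp
  note l = lookup_calc[OF assms(2) this, of enc_arcs]
  ultimately show "wp prog [enc_arcs A, enc_nat s, enc_nat t] (prog ! 6)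
    (\<lambda>y' t'. y' = enc_option enc_entry (search A s t) \<and> t' \<le> T_search N)"
    using l(3) by (simp add: search_body_def search_def T_search_def r(1,2) l(1,2))
qed simp

lemmas search_calc = computesD[OF computes_search]

lemma restrict_arcs_simps:
  "restrict_arcs b c [] = []"
  "restrict_arcs b c (x # A) = (if ahead x \<noteq> ahead b \<or> alabel x = alabel c
     then x # restrict_arcs b c A else restrict_arcs b c A)"
  by (simp_all add: restrict_arcs_def)

lemma del_label_simps:
  "del_label a [] = []"
  "del_label a (x # A) = (if alabel x = alabel a then del_label a A else x # del_label a A)"
  by (simp_all add: del_label_def)

lemma computes_restrict_arcs:
  assumes "\<forall>x \<in> set A. arc_le N x"
  shows "computes prog 7 [enc_arc b, enc_arc c, enc_arcs A] (enc_arcs (restrict_arcs b c A))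
    ((2 * T_eq N + 60) * (length A + 1))"
  using assms
proof (induction A)
  case Nil
  show ?case by (rule computesI) (simp_all add: restrict_arcs_body_def restrict_arcs_simps)
next
  case (Cons x A)
  then have IH: "computes prog 7 [enc_arc b, enc_arc c, enc_arcs A] (enc_arcs (restrict_arcs b c A))
    ((2 * T_eq N + 60) * (length A + 1))" by simp
  note IH = computesD[OF IH]
  have e: "time prog (Suc 0) [enc_nat (ahead x), enc_nat (ahead b)] \<le> T_eq N"
    "time prog (Suc 0) [enc_nat (alabel x), enc_nat (alabel c)] \<le> T_eq N"
    using Cons.prems by (auto intro!: eq_time simp: arc_le_def)
  show ?case
    by (rule computesI) (use IH(3) e in
      \<open>auto simp: restrict_arcs_body_def restrict_arcs_simps
        eq_calc IH(1,2)\<close>)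
qed

lemma computes_del_label:
  assumes "\<forall>x \<in> set A. arc_le N x"
  shows "computes prog 8 [enc_arc a, enc_arcs A] (enc_arcs (del_label a A))
    ((2 * T_eq N + 60) * (length A + 1))"
  using assms
proof (induction A)
  case Nil
  show ?case by (rule computesI) (simp_all add: del_label_body_def del_label_simps)
next
  case (Cons x A)
  then have IH: "computes prog 8 [enc_arc a, enc_arcs A] (enc_arcs (del_label a A))
    ((2 * T_eq N + 60) * (length A + 1))" by simp
  note IH = computesD[OF IH]
  have e: "time prog (Suc 0) [enc_nat (alabel x), enc_nat (alabel a)] \<le> T_eq N"
    using Cons.prems by (auto intro!: eq_time simp: arc_le_def)
  show ?case
    by (rule computesI) (use IH(3) e in
      \<open>auto simp: del_label_body_def del_label_simps
        eq_calc IH(1,2)\<close>)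
qed

lemma filter_calc:
  assumes "small N A"
  shows "computes prog 7 [enc_arc b, enc_arc c, enc_arcs A] (enc_arcs (restrict_arcs b c A)) (T_filter N)"
    "computes prog 8 [enc_arc a, enc_arcs A] (enc_arcs (del_label a A)) (T_filter N)"
proof -
  have A: "\<forall>x \<in> set A. arc_le N x" using assms by (simp add: small_def)
  have le: "(2 * T_eq N + 60) * (length A + 1) \<le> T_filter N"
    unfolding T_filter_def using times_Suc_le[OF order_refl small_length[OF assms]] .
  show "computes prog 7 [enc_arc b, enc_arc c, enc_arcs A] (enc_arcs (restrict_arcs b c A)) (T_filter N)"
    by (rule computes_mono[OF computes_restrict_arcs[OF A] le])
  show "computes prog 8 [enc_arc a, enc_arcs A] (enc_arcs (del_label a A)) (T_filter N)"
    by (rule computes_mono[OF computes_del_label[OF A] le])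
qed

section \<open>Running times of the two cycle searches\<close>

lemma computes_dicycle_through:
  assumes "small N A" "arc_le N a"
  shows "computes prog 11 [enc_arcs A, enc_arc a, enc_arc b, enc_arc c]
    (enc_arcs (dicycle_through A a b c)) (T_dicycle N)"
proof (rule computesI)
  note f = computesD[OF filter_calc(1)[OF assms(1), of b c]]
  have "small N (restrict_arcs b c A)" "ahead a \<le> N"
    using assms small_filter by (auto simp: restrict_arcs_def arc_le_def)
  note s = search_calc[OF this, of "atail a"]
  show "wp prog [enc_arcs A, enc_arc a, enc_arc b, enc_arc c] (prog ! 11)
    (\<lambda>y t. y = enc_arcs (dicycle_through A a b c) \<and> t \<le> T_dicycle N)"
    using f(3) s(3)
    by (cases "search (restrict_arcs b c A) (ahead a) (atail a)")
      (simp_all add: dicycle_through_body_def dicycle_through_def T_dicycle_def f(1,2) s(1,2))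
qed simp

lemma computes_avoid:
  assumes "\<forall>x \<in> set A. arc_le N x" "length B \<le> N"
  shows "computes prog 9 [enc_arcs B, enc_arcs A] (enc_arcs (avoid B A))
    ((2 * T_lookup N + 80) * (length A + 1))"
  using assms(1)
proof (induction A)
  case Nil
  show ?case by (rule computesI) (simp_all add: avoid_body_def)
next
  case (Cons x A)
  then have IH: "computes prog 9 [enc_arcs B, enc_arcs A] (enc_arcs (avoid B A))
    ((2 * T_lookup N + 80) * (length A + 1))" by simp
  note IH = computesD[OF IH]
  have le: "atail x \<le> N" "ahead x \<le> N" using Cons.prems by (auto simp: arc_le_def)
  note t = lookup_calc[OF le(1) assms(2), of "enc_pair enc_nat enc_nat"]
    and h = lookup_calc[OF le(2) assms(2), of "enc_pair enc_nat enc_nat"]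
  show ?case
  proof (rule computesI)
    show "wp prog [enc_arcs B, enc_arcs (x # A)] (prog ! 9)
      (\<lambda>y t. y = enc_arcs (avoid B (x # A)) \<and> t \<le> (2 * T_lookup N + 80) * (length (x # A) + 1))"
      using t(3) h(3) IH(3)
      by (cases "lookup (atail x) B"; cases "lookup (ahead x) B")
        (simp_all add: avoid_body_def t(1,2) h(1,2) IH(1,2))
  qed simp
qed

lemma computes_ucycle:
  assumes "small N X" "\<forall>x \<in> set Y. arc_le N x"
  shows "computes prog 10 [enc_arcs X, enc_arcs Y] (enc_arcs (ucycle X Y))
    ((2 * T_filter N + 2 * T_search N + 80) * (length Y + 1))"
  using assms(2)
proof (induction Y)
  case Nil
  show ?case by (rule computesI) (simp_all add: ucycle_body_def)
next
  case (Cons a Y)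
  then have IH: "computes prog 10 [enc_arcs X, enc_arcs Y] (enc_arcs (ucycle X Y))
    ((2 * T_filter N + 2 * T_search N + 80) * (length Y + 1))" by simp
  note IH = computesD[OF IH]
  note f = computesD[OF filter_calc(2)[OF assms(1), of a]]
  have "small N (del_label a X)" "ahead a \<le> N"
    using assms(1) small_filter Cons.prems by (auto simp: del_label_def arc_le_def)
  note s = search_calc[OF this, of "atail a"]
  show ?case
  proof (rule computesI)
    show "wp prog [enc_arcs X, enc_arcs (a # Y)] (prog ! 10)
      (\<lambda>y t. y = enc_arcs (ucycle X (a # Y)) \<and>
        t \<le> (2 * T_filter N + 2 * T_search N + 80) * (length (a # Y) + 1))"
      using f(3) s(3) IH(3)
      by (cases "search (del_label a X) (ahead a) (atail a)")
        (simp_all add: ucycle_body_def f(1,2) s(1,2) IH(1,2))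
  qed simp
qed

lemma computes_labels:
  "computes prog 12 [enc_arcs B] (enc_list enc_nat (map alabel B)) (20 * (length B + 1))"
proof (induction B)
  case Nil
  show ?case by (rule computesI) (simp_all add: labels_body_def)
next
  case (Cons x B)
  note IH = computesD[OF Cons.IH]
  show ?case by (rule computesI) (use IH(3) in \<open>simp_all add: labels_body_def IH(1,2)\<close>)
qed

lemma computes_answer_pair:
  assumes "length B \<le> N" "length C \<le> N"
  shows "computes prog 13 [enc_arcs B, enc_arcs C] (enc_answer (answer_pair B C)) (40 * (N + 1) + 20)"
proof (rule computesI)
  note b = computesD[OF computes_labels[of B]] and c = computesD[OF computes_labels[of C]]
  show "wp prog [enc_arcs B, enc_arcs C] (prog ! 13)
    (\<lambda>y t. y = enc_answer (answer_pair B C) \<and> t \<le> 40 * (N + 1) + 20)"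
    using b(3) c(3) assms
    by (auto simp: answer_pair_body_def answer_pair_def enc_answer_def b(1,2) c(1,2))
qed simp

lemma length_avoid: "length (avoid B A) \<le> 2 * length A"
  by (induction A) simp_all

definition fits :: "nat \<Rightarrow> larc list \<Rightarrow> bool" where
  "fits N A \<longleftrightarrow> (\<forall>x \<in> set A. arc_le N x) \<and> (2 * length A) * (2 * length A) + 2 * length A + 1 \<le> N"

lemma avoid_arc_le: "\<forall>x \<in> set A. arc_le N x \<Longrightarrow> \<forall>x \<in> set (avoid B A). arc_le N x"
proof (induction A)
  case (Cons x A)
  then have "\<forall>y \<in> set (avoid B A). arc_le N y" "arc_le N x" by simp_all
  moreover then have "arc_le N (ahead x, atail x, alabel x)" by (simp add: arc_le_def)
  ultimately show ?case by simp
qed simp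

lemma fits_small:
  assumes "fits N A"
  shows "small N A" "small N (avoid B A)"
proof -
  show "small N A" using assms by (auto simp: fits_def small_def)
  have "\<forall>x \<in> set (avoid B A). arc_le N x"
    using avoid_arc_le assms unfolding fits_def by blast
  moreover have "length (avoid B A) * length (avoid B A) + length (avoid B A) + 1
      \<le> (2 * length A) * (2 * length A) + 2 * length A + 1"
    using length_avoid[of B A] by (intro add_mono mult_le_mono) auto
  ultimately show "small N (avoid B A)" using assms unfolding small_def fits_def by linarith
qed

text \<open>Needed for the running time: writing the answer takes time proportional to the length of
  the cycle.\<close>

lemma length_ucycle: "length (ucycle X Y) \<le> Suc (length X * length X)"
proof (cases "ucycle X Y = []")
  case False
  then obtain a e where a: "search (del_label a X) (ahead a) (atail a) = Some e" "ucycle X Y = a # snd e"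
    using ucycle_Cons by blast
  have "length (del_label a X) * length (del_label a X) \<le> length X * length X"
    by (intro mult_le_mono) (simp_all add: del_label_def)
  then show ?thesis using search_length[OF a(1)] a(2) by simp
qed simp

text \<open>Needed for the running time: \<open>avoid\<close> looks up vertices in the dicycle, so
  the length must stay below \<open>N\<close>.\<close>

lemma length_dicycle_through: "length (dicycle_through A a b c) \<le> Suc (length A * length A)"
proof (cases "search (restrict_arcs b c A) (ahead a) (atail a)")
  case (Some e)
  have "length (restrict_arcs b c A) * length (restrict_arcs b c A) \<le> length A * length A"
    by (intro mult_le_mono) (simp_all add: restrict_arcs_def)
  then show ?thesis using search_length[OF Some] Some by (simp add: dicycle_through_def)
qed (simp add: dicycle_through_def)

lemma computes_complete_dicycle:
  assumes "fits N A" "length B \<le> N"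
  shows "computes prog 14 [enc_arcs A, enc_arcs B] (enc_answer (complete_dicycle A B)) (T_complete N)"
proof (rule computesI)
  let ?X = "avoid B A"
  note sm = fits_small[OF assms(1)]
  have A: "\<forall>x \<in> set A. arc_le N x" and X: "\<forall>x \<in> set ?X. arc_le N x"
    using sm(1) sm(2)[of B] by (auto simp: small_def)
  note a = computesD[OF computes_avoid[OF A assms(2)]]
  have a3: "time prog 9 [enc_arcs B, enc_arcs A] \<le> T_avoid N"
    using times_Suc_le[OF a(3) small_length[OF sm(1)]] by (simp add: T_avoid_def)
  note u = computesD[OF computes_ucycle[OF sm(2) X]]
  have u3: "time prog 10 [enc_arcs ?X, enc_arcs ?X] \<le> T_ucycle N"
    using times_Suc_le[OF u(3) small_length[OF sm(2)]] by (simp add: T_ucycle_def)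
  have "length (ucycle ?X ?X) \<le> N"
    using length_ucycle[of ?X ?X] sm(2)[of B] by (simp add: small_def)
  note p = computesD[OF computes_answer_pair[OF assms(2) this]]
  show "wp prog [enc_arcs A, enc_arcs B] (prog ! 14)
    (\<lambda>y t. y = enc_answer (complete_dicycle A B) \<and> t \<le> T_complete N)"
    using a3 u3 p(3)
    by (auto simp: complete_dicycle_body_def complete_dicycle_def T_complete_def enc_answer_def[of None]
      a(1,2) u(1,2) p(1,2))
qed simp

lemma enc_answer_simps [simp]: "enc_answer None = Leaf" "enc_answer (Some y) \<noteq> Leaf"
  by (simp_all add: enc_answer_def)

section \<open>Running times of the loops and of the whole program\<close>

lemma computes_try_c:
  assumes "fits N A" "arc_le N a"
  shows "computes prog 15 [enc_arcs A, enc_arc a, enc_arc b, enc_arcs L] (enc_answer (try_c A a b L))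
    ((2 * T_complete N + 2 * T_dicycle N + 80) * (length L + 1))"
proof (induction L)
  case Nil
  show ?case by (rule computesI) (simp_all add: try_c_body_def)
next
  case (Cons c L)
  let ?B = "dicycle_through A a b c"
  note IH = computesD[OF Cons.IH]
  note d = computesD[OF computes_dicycle_through[OF fits_small(1)[OF assms(1)] assms(2), of b c]]
  have "length ?B \<le> N"
    using length_dicycle_through[of A a b c] fits_small(1)[OF assms(1)] by (simp add: small_def)
  note p = computesD[OF computes_complete_dicycle[OF assms(1) this]]
  show ?case
  proof (rule computesI)
    show "wp prog [enc_arcs A, enc_arc a, enc_arc b, enc_arcs (c # L)] (prog ! 15)
      (\<lambda>y t. y = enc_answer (try_c A a b (c # L)) \<and>
        t \<le> (2 * T_complete N + 2 * T_dicycle N + 80) * (length (c # L) + 1))"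
      using d(3) p(3) IH(3)
      by (cases "complete_dicycle A ?B") (simp_all add: try_c_body_def d(1,2) p(1,2) IH(1,2))
  qed simp
qed

lemma computes_try_b:
  assumes "fits N A" "arc_le N a"
  shows "computes prog 16 [enc_arcs A, enc_arc a, enc_arcs L] (enc_answer (try_b A a L))
    ((2 * T_try_c N + 80) * (length L + 1))"
proof (induction L)
  case Nil
  show ?case by (rule computesI) (simp_all add: try_b_body_def)
next
  case (Cons b L)
  note IH = computesD[OF Cons.IH]
  note p = computesD[OF computes_try_c[OF assms, of b A]]
  have p3: "time prog 15 [enc_arcs A, enc_arc a, enc_arc b, enc_arcs A] \<le> T_try_c N"
    using times_Suc_le[OF p(3) small_length[OF fits_small(1)[OF assms(1)]]] by (simp add: T_try_c_def)
  show ?case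
  proof (rule computesI)
    show "wp prog [enc_arcs A, enc_arc a, enc_arcs (b # L)] (prog ! 16)
      (\<lambda>y t. y = enc_answer (try_b A a (b # L)) \<and> t \<le> (2 * T_try_c N + 80) * (length (b # L) + 1))"
      using p3 IH(3)
      by (cases "try_c A a b A") (simp_all add: try_b_body_def p(1,2) IH(1,2))
  qed simp
qed

lemma computes_try_a:
  assumes "fits N A" "\<forall>a \<in> set L. arc_le N a"
  shows "computes prog 17 [enc_arcs A, enc_arcs L] (enc_answer (try_a A L))
    ((2 * T_try_b N + 80) * (length L + 1))"
  using assms(2)
proof (induction L)
  case Nil
  show ?case by (rule computesI) (simp_all add: try_a_body_def)
next
  case (Cons a L)
  then have IH: "computes prog 17 [enc_arcs A, enc_arcs L] (enc_answer (try_a A L))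
    ((2 * T_try_b N + 80) * (length L + 1))" and "arc_le N a" by simp_all
  note IH = computesD[OF IH]
  note p = computesD[OF computes_try_b[OF assms(1) \<open>arc_le N a\<close>, of A]]
  have p3: "time prog 16 [enc_arcs A, enc_arc a, enc_arcs A] \<le> T_try_b N"
    using times_Suc_le[OF p(3) small_length[OF fits_small(1)[OF assms(1)]]] by (simp add: T_try_b_def)
  show ?case
  proof (rule computesI)
    show "wp prog [enc_arcs A, enc_arcs (a # L)] (prog ! 17)
      (\<lambda>y t. y = enc_answer (try_a A (a # L)) \<and> t \<le> (2 * T_try_b N + 80) * (length (a # L) + 1))"
      using p3 IH(3)
      by (cases "try_b A a A") (simp_all add: try_a_body_def p(1,2) IH(1,2))
  qed simp
qed

lemma computes_number_arcs:
  "computes prog 18 [enc_nat k, enc_list (enc_pair enc_nat enc_nat) as] (enc_arcs (number_arcs k as))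
    (40 * (length as + 1))"
proof (induction as arbitrary: k)
  case Nil
  show ?case by (rule computesI) (simp_all add: number_arcs_body_def)
next
  case (Cons a as)
  note IH = computesD[OF Cons.IH[of "Suc k"], simplified]
  show ?case by (rule computesI) (use IH(3) in \<open>simp_all add: number_arcs_body_def IH(1,2)\<close>)
qed

text \<open>This is \<open>(2 * n) * (2 * n) + 2 * n + 1\<close>, which \<open>fits\<close> demands
  for \<open>n\<close> arcs. It also exceeds all vertices and labels, which are below the input
  size.\<close>

definition "size_bound (n :: nat) = 4 * (n * n) + 2 * n + 1"

lemma length_number_arcs: "length (number_arcs k as) = length as"
  by (induction as arbitrary: k) auto

lemma fits_number_arcs:
  assumes "wf_input I"
  shows "fits (size_bound (input_size I)) (number_arcs 0 (snd I))"
proof -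
  let ?n = "input_size I"
  let ?l = "length (snd I)"
  have l: "?l \<le> ?n" by (simp add: input_size_def)
  have "arc_le (size_bound ?n) x" if x: "x \<in> set (number_arcs 0 (snd I))" for x
  proof -
    obtain i where i: "i < ?l" "x = (fst (snd I ! i), snd (snd I ! i), i)"
      using x unfolding set_number_arcs by auto
    have "snd I ! i \<in> set (snd I)" using i by simp
    then have "fst (snd I ! i) < fst I" "snd (snd I ! i) < fst I"
      using assms by (auto simp: wf_input_def split_beta)
    then show ?thesis using i by (auto simp: arc_le_def size_bound_def input_size_def)
  qed
  moreover have "(2 * ?l) * (2 * ?l) + 2 * ?l + 1 \<le> size_bound ?n"
    using mult_le_mono[OF l l] l by (simp add: size_bound_def)
  ultimately show ?thesis by (simp add: fits_def length_number_arcs)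
qed

text \<open>The factor 80 is twice 40, because the numbered arc list is computed twice.\<close>

definition "T_solve (n :: nat) = T_try_a (size_bound n) + 80 * (n + 1) + 40"

lemma computes_solve:
  assumes "wf_input I"
  shows "computes prog 0 [enc_digraph I] (enc_answer (solve I)) (T_solve (input_size I))"
proof (rule computesI)
  let ?A = "number_arcs 0 (snd I)"
  let ?N = "size_bound (input_size I)"
  note f = fits_number_arcs[OF assms]
  note n = computesD[OF computes_number_arcs[of 0 "snd I"], simplified]
  have "\<forall>x \<in> set ?A. arc_le ?N x" using f by (simp add: fits_def)
  note p = computesD[OF computes_try_a[OF f this]]
  have "time prog 17 [enc_arcs ?A, enc_arcs ?A] \<le> T_try_a ?N"
    using times_Suc_le[OF p(3) small_length[OF fits_small(1)[OF f]]] by (simp add: T_try_a_def)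
  moreover have "time prog 18 [Leaf, enc_list (enc_pair enc_nat enc_nat) (snd I)] \<le> 40 * (input_size I + 1)"
    using n(3) by (simp add: input_size_def)
  ultimately show "wp prog [enc_digraph I] (prog ! 0)
    (\<lambda>y t. y = enc_answer (solve I) \<and> t \<le> T_solve (input_size I))"
    by (simp add: solve_body_def solve_def Let_def enc_digraph_def T_solve_def n(1,2) p(1,2))
qed simp

lemma polynomial_fun_size_bound: "polynomial_fun size_bound"
  unfolding size_bound_def[abs_def] by (intro polynomial_funI)

lemma polynomial_fun_T_solve: "polynomial_fun T_solve"
proof -
  have "polynomial_fun T_try_a"
    unfolding T_try_a_def[abs_def] T_try_b_def T_try_c_def T_complete_def T_ucycle_def T_dicycle_def
      T_avoid_def T_filter_def T_search_def T_rounds_def T_pass_def T_extend_def T_lookup_def T_eq_def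
    by (intro polynomial_funI)
  then show ?thesis
    unfolding T_solve_def[abs_def]
    by (intro polynomial_funI polynomial_fun_comp[OF _ polynomial_fun_size_bound])
qed

theorem theorem8:
  shows "poly_time_solvable enc_digraph enc_answer input_size
    (\<lambda>I. wf_input I \<and> unique_nontrivial_scc_subdivided_multiwheel (digraph_of I))
    (\<lambda>I ans. correct_answer (digraph_of I) ans)"
proof -
  obtain q where q: "\<forall>n. T_solve n = poly q n"
    using polynomial_fun_T_solve unfolding polynomial_fun_def by blast
  show ?thesis
    unfolding poly_time_solvable_def
  proof (intro exI[of _ prog] exI[of _ q] allI impI, elim conjE)
    fix I
    assume wf: "wf_input I" and m: "unique_nontrivial_scc_subdivided_multiwheel (digraph_of I)"
    have "\<exists>t. run prog (enc_digraph I) (enc_answer (solve I)) t \<and> t \<le> poly q (input_size I)"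
      unfolding q[rule_format, symmetric] by (rule computes_run[OF computes_solve[OF wf]])
    then obtain t where "run prog (enc_digraph I) (enc_answer (solve I)) t" "t \<le> poly q (input_size I)"
      by (elim exE conjE)
    moreover have "correct_answer (digraph_of I) (solve I)"
      using input_digraph.solve_correct[OF input_digraph.intro[OF wf] m] .
    ultimately show "\<exists>y t. run prog (enc_digraph I) (enc_answer y) t \<and> t \<le> poly q (input_size I) \<and>
        correct_answer (digraph_of I) y"
      by blast
  qed
qed

end
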